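(* Let $\mathscr{S}$ be a semiring that is effectively separated by morphisms of finite image. Let $r,n\ge1$, let $\alpha,\eta\in\mathscr{S}^{1\times n}$, let $\mu:\Sigma_r^*\to\mathscr{S}^{n\times n}$ be a morphism, and let $\beta\in\mathscr{S}^{n\times1}$, $M\in\mathscr{S}^{n\times n}$, $\gamma\in\mathscr{S}$. Then the following sets are all constructible rational languages: $$\{w\in\Sigma_r^*\mid\alpha\mu(w)\beta=\gamma\},\qquad \{w\in\Sigma_r^*\mid\alpha\mu(w)=\eta\},\qquad \{w\in\Sigma_r^*\mid\mu(w)=M\}.$$
   Context: $\Sigma_r=\{a_1,\dots,a_r\}$ is an alphabet with $r$ letters and $\Sigma_r^*$ is the free monoid on $\Sigma_r$ (finite, possibly empty, words); a language is a subset of $\Sigma_r^*$. A morphism $\mu:\Sigma_r^*\to\mathscr{S}^{n\times n}$ is a morphism of monoids into the multiplicative monoid of $n\times n$ matrices over $\mathscr{S}$; it is given by the matrices $\mu(a_1),\dots,\mu(a_r)$. A rational language is one recognized by a finite automaton; equivalently (Kleene--Schützenberger) it has the form $\kappa^{-1}(F)$ with $\kappa$ a morphism from $\Sigma_r^*$ to a finite monoid $P$ and $F\subset P$. Constructible means that such a description ($P$, $F$, $\kappa$, or an automaton) can be effectively computed from the data. A semiring is a set with an addition and a multiplication such that it is a commutative monoid for addition, a monoid for multiplication, multiplication distributes on both sides over addition, and the zero element is absorbing on both sides. The elements of $\mathscr{S}$ are assumed to be represented in some effective way, with sum, product and equality available through oracles. $\mathscr{S}$ is separated by morphisms of finite image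 if for all $\gamma\in\mathscr{S}$ there is a finite semiring $\mathscr{S}_\gamma$ and a semiring morphism $\pi_\gamma:\mathscr{S}\to\mathscr{S}_\gamma$ such that $\pi_\gamma^{-1}(\pi_\gamma(\gamma))=\{\gamma\}$. It is effectively separated by morphisms of finite image if moreover the maps $\gamma\mapsto\mathscr{S}_\gamma$ and $\gamma\mapsto\pi_\gamma$ are effective: for any $\gamma\in\mathscr{S}$ one can compute the finite set of elements of $\mathscr{S}_\gamma$ together with its addition and multiplication tables, and one can compute $\pi_\gamma(y)$ for any $y\in\mathscr{S}$. *)

theory Defs
  imports
    "HOL-Library.Nat_Bijection"
    "HOL-Algebra.Ring"
    "Jordan_Normal_Form.Matrix"
begin

section \<open>Computability relative to oracles\<close>

text \<open>
  Partial recursive functions relative to a set of partial functions (the oracles). As all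
  functions are unary, several arguments are packed with \<^const>\<open>prod_encode\<close>; finite
  sequences are coded with \<^const>\<open>list_encode\<close>. Identity and constants are derived
  (pair the two projections, iterate successor on zero). Oracles are partial so that
  they may behave arbitrarily on numbers that do not represent anything.
\<close>

definition primrec_comb ::
  "(nat \<rightharpoonup> nat) \<Rightarrow> (nat \<rightharpoonup> nat) \<Rightarrow> nat \<rightharpoonup> nat" where
  "primrec_comb f g x =
     (case prod_decode x of (a, n) \<Rightarrow>
        rec_nat (f a)
          (\<lambda>m acc. Option.bind acc (\<lambda>v. g (prod_encode (a, prod_encode (m, v))))) n)"

text \<open>Unbounded search is defined at \<open>a\<close> only if the search meets a zero of \<open>f\<close> before any
  argument at which \<open>f\<close> is undefined.\<close>

definition minimisation :: "(nat \<rightharpoonup> nat) \<Rightarrow> nat \<rightharpoonup> nat" where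
  "minimisation f a =
     (if \<exists>n. f (prod_encode (a, n)) = Some 0 \<and> (\<forall>m<n. f (prod_encode (a, m)) \<noteq> None)
      then Some (LEAST n. f (prod_encode (a, n)) = Some 0)
      else None)"

inductive recursive_in :: "(nat \<rightharpoonup> nat) set \<Rightarrow> (nat \<rightharpoonup> nat) \<Rightarrow> bool" for Or where
  zero: "recursive_in Or (\<lambda>x. Some 0)"
| succ: "recursive_in Or (\<lambda>x. Some (Suc x))"
| left: "recursive_in Or (\<lambda>x. Some (fst (prod_decode x)))"
| right: "recursive_in Or (\<lambda>x. Some (snd (prod_decode x)))"
| query: "g \<in> Or \<Longrightarrow> recursive_in Or g"
| pair: "recursive_in Or f \<Longrightarrow> recursive_in Or g \<Longrightarrow>
    recursive_in Or
      (\<lambda>x. Option.bind (f x) (\<lambda>a. Option.bind (g x) (\<lambda>b. Some (prod_encode (a, b)))))"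
| comp: "recursive_in Or f \<Longrightarrow> recursive_in Or g \<Longrightarrow>
    recursive_in Or (\<lambda>x. Option.bind (f x) g)"
| prec: "recursive_in Or f \<Longrightarrow> recursive_in Or g \<Longrightarrow> recursive_in Or (primrec_comb f g)"
| minim: "recursive_in Or f \<Longrightarrow> recursive_in Or (minimisation f)"


section \<open>Effectively separated semirings\<close>

text \<open>
  A semiring is a type of sort \<open>{semiring_0, monoid_mult}\<close>; the library class
  \<^class>\<open>semiring_1\<close> is not used because it excludes the semiring with \<open>0 = 1\<close>.

  Elements are represented by natural numbers: \<open>repr c = Some x\<close> means that \<open>c\<close> is a code
  of \<open>x\<close>. An element may have many codes and a number need not be a code, which is why
  equality has to be decided separately.
\<close>

definition effective_representation ::
  "(nat \<Rightarrow> 's::{semiring_0,monoid_mult} option) \<Rightarrow> (nat \<rightharpoonup> nat) \<Rightarrow> (nat \<rightharpoonup> nat) \<Rightarrow>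
   (nat \<rightharpoonup> nat) \<Rightarrow> bool" where
  "effective_representation repr sum_or prod_or eq_or \<longleftrightarrow>
     (\<forall>x. \<exists>c. repr c = Some x) \<and>
     (\<forall>c d x y. repr c = Some x \<longrightarrow> repr d = Some y \<longrightarrow>
        (\<exists>e. sum_or (prod_encode (c, d)) = Some e \<and> repr e = Some (x + y)) \<and>
        (\<exists>e. prod_or (prod_encode (c, d)) = Some e \<and> repr e = Some (x * y)) \<and>
        eq_or (prod_encode (c, d)) = Some (if x = y then 1 else 0))"

text \<open>The library's \<^const>\<open>ring_hom\<close> does not ask for preservation of zero, which is not
  automatic for semirings.\<close>

definition semiring_morphism ::
  "('s::{semiring_0,monoid_mult} \<Rightarrow> 'b) \<Rightarrow> ('b, 'm) ring_scheme \<Rightarrow> bool" where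
  "semiring_morphism h R \<longleftrightarrow>
     (\<forall>x. h x \<in> carrier R) \<and>
     h 0 = \<zero>\<^bsub>R\<^esub> \<and> h 1 = \<one>\<^bsub>R\<^esub> \<and>
     (\<forall>x y. h (x + y) = h x \<oplus>\<^bsub>R\<^esub> h y) \<and>
     (\<forall>x y. h (x * y) = h x \<otimes>\<^bsub>R\<^esub> h y)"

text \<open>Naming the elements of the finite semirings by natural numbers is no restriction.\<close>

definition separated_via ::
  "('s::{semiring_0,monoid_mult} \<Rightarrow> nat ring) \<Rightarrow> ('s \<Rightarrow> 's \<Rightarrow> nat) \<Rightarrow> bool" where
  "separated_via R \<pi> \<longleftrightarrow>
     (\<forall>\<gamma>. semiring (R \<gamma>) \<and> finite (carrier (R \<gamma>)) \<and>
          semiring_morphism (\<pi> \<gamma>) (R \<gamma>) \<and> \<pi> \<gamma> -` {\<pi> \<gamma> \<gamma>} = {\<gamma>})"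

definition op_table :: "nat list \<Rightarrow> (nat \<Rightarrow> nat \<Rightarrow> nat) \<Rightarrow> nat" where
  "op_table es f = list_encode (map (\<lambda>x. list_encode (map (f x) es)) es)"

definition codes_tables :: "nat \<Rightarrow> nat ring \<Rightarrow> bool" where
  "codes_tables k R \<longleftrightarrow>
     (\<exists>es. set es = carrier R \<and>
        k = list_encode
              [list_encode es,
               op_table es (\<lambda>x y. x \<oplus>\<^bsub>R\<^esub> y),
               op_table es (\<lambda>x y. x \<otimes>\<^bsub>R\<^esub> y)])"

definition effectively_separated ::
  "(nat \<rightharpoonup> nat) set \<Rightarrow> (nat \<Rightarrow> 's::{semiring_0,monoid_mult} option) \<Rightarrow> bool" where
  "effectively_separated Or repr \<longleftrightarrow>
     (\<exists>R \<pi>. separated_via R \<pi> \<and>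
        (\<exists>t. recursive_in Or t \<and>
           (\<forall>c \<gamma>. repr c = Some \<gamma> \<longrightarrow> (\<exists>k. t c = Some k \<and> codes_tables k (R \<gamma>)))) \<and>
        (\<exists>p. recursive_in Or p \<and>
           (\<forall>c d \<gamma> y. repr c = Some \<gamma> \<longrightarrow> repr d = Some y \<longrightarrow>
              p (prod_encode (c, d)) = Some (\<pi> \<gamma> y))))"


section \<open>Morphisms into matrices\<close>

text \<open>The letters of the alphabet with \<open>r\<close> letters are \<open>0, \<dots>, r - 1\<close>, and its free monoid
  is \<open>lists {..<r}\<close>.\<close>

definition matrix_morphism ::
  "nat \<Rightarrow> nat \<Rightarrow> (nat list \<Rightarrow> 's::{semiring_0,monoid_mult} mat) \<Rightarrow> bool" where
  "matrix_morphism r n \<mu> \<longleftrightarrow>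
     (\<forall>w\<in>lists {..<r}. \<mu> w \<in> carrier_mat n n) \<and>
     \<mu> [] = 1\<^sub>m n \<and>
     (\<forall>u\<in>lists {..<r}. \<forall>v\<in>lists {..<r}. \<mu> (u @ v) = \<mu> u * \<mu> v)"

text \<open>A matrix is coded row by row; a morphism is coded by its values at the letters.\<close>

definition codes_matrix :: "(nat \<Rightarrow> 's option) \<Rightarrow> nat \<Rightarrow> 's mat \<Rightarrow> bool" where
  "codes_matrix repr k A \<longleftrightarrow>
     list_all2 (list_all2 (\<lambda>c x. repr c = Some x))
       (map list_decode (list_decode k)) (mat_to_list A)"

definition codes_morphism ::
  "(nat \<Rightarrow> 's option) \<Rightarrow> nat \<Rightarrow> nat \<Rightarrow> (nat list \<Rightarrow> 's mat) \<Rightarrow> bool" where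
  "codes_morphism repr r k \<mu> \<longleftrightarrow>
     list_all2 (codes_matrix repr) (list_decode k) (map (\<lambda>a. \<mu> [a]) [0..<r])"


section \<open>Rational languages\<close>

record automaton =
  states :: "nat list"
  initials :: "nat list"
  transitions :: "(nat \<times> nat \<times> nat) list"
  finals :: "nat list"

definition finite_automaton :: "nat \<Rightarrow> automaton \<Rightarrow> bool" where
  "finite_automaton r A \<longleftrightarrow>
     set (initials A) \<subseteq> set (states A) \<and> set (finals A) \<subseteq> set (states A) \<and>
     set (transitions A) \<subseteq> set (states A) \<times> {..<r} \<times> set (states A)"

fun run :: "(nat \<times> nat \<times> nat) set \<Rightarrow> nat \<Rightarrow> nat list \<Rightarrow> nat \<Rightarrow> bool" where
  "run D p [] q \<longleftrightarrow> p = q"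
| "run D p (a # w) q \<longleftrightarrow> (\<exists>s. (p, a, s) \<in> D \<and> run D s w q)"

definition recognized :: "automaton \<Rightarrow> nat list set" where
  "recognized A =
     {w. \<exists>p\<in>set (initials A). \<exists>q\<in>set (finals A). run (set (transitions A)) p w q}"

definition rational_language :: "nat \<Rightarrow> nat list set \<Rightarrow> bool" where
  "rational_language r L \<longleftrightarrow> (\<exists>A. finite_automaton r A \<and> recognized A = L)"

definition automaton_code :: "automaton \<Rightarrow> nat" where
  "automaton_code A =
     list_encode
       [list_encode (states A),
        list_encode (initials A),
        list_encode (map (\<lambda>(p, a, q). list_encode [p, a, q]) (transitions A)),
        list_encode (finals A)]"

text \<open>The output of a computation is (defined and) an automaton recognizing \<open>L\<close>. A language
  is constructible from given data if some computable function yields such an output on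
  every code of the data.\<close>

definition outputs_automaton_for :: "nat option \<Rightarrow> nat \<Rightarrow> nat list set \<Rightarrow> bool" where
  "outputs_automaton_for res r L \<longleftrightarrow>
     (\<exists>A. res = Some (automaton_code A) \<and> finite_automaton r A \<and> recognized A = L)"

end

theory Submission
  imports Defs
begin

text \<open>
  Why the languages are rational: let \<open>\<pi>\<close> be a morphism to a finite semiring that maps no other
  element to the image of \<open>\<gamma>\<close>. Then \<open>\<alpha> \<mu>(w) \<beta> = \<gamma>\<close> holds if and only if the images agree,
  and the image of the left side can be computed letter by letter: the image of the row
  \<open>\<alpha> \<mu>(w)\<close> is one of finitely many rows over the finite semiring, and reading a letter \<open>a\<close>
  multiplies it by the image of \<open>\<mu>(a)\<close>. These rows are the states of a deterministic automaton
  (\<open>machine_run\<close>, \<open>machine_accepts_iff\<close>). An equation between rows or matrices is a finite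
  conjunction of such scalar tests, with unit vectors in place of \<open>\<alpha>\<close> and \<open>\<beta>\<close>. As every
  test has its own finite semiring, the conjunction is decided by running one machine per test in
  parallel (\<open>parallel_correct\<close>).

  Why the automata are constructible: the oracles enter only through the two given
  computations, which yield the operation tables of the finite semirings and the images of
  the given matrix entries. These computations may be undefined on numbers that are not codes, so this first
  stage is a partial computation (\<open>computable_start_state\<close>). Everything after it, including
  the enumeration of all states, is a total manipulation of lists of natural numbers. To
  avoid handling realizers on numbers, computability is formulated for functions between types whose
  elements have codes, and it is derived by rules that follow the syntax of the function
  (\<open>computable_on\<close> and the rules collected in \<open>computable_intros\<close>). The two stages are
  joined in \<open>compile_tests\<close>. The three parts of the theorem on constructibility are
  instances of it, and rationality follows from them because all data have codes.
\<close>

section \<open>Data encoded by natural numbers\<close>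

text \<open>
  The encodings agree with \<^const>\<open>prod_encode\<close> and \<^const>\<open>list_encode\<close> on the nose. A
  function on lists and its counterpart on list codes therefore have the same realizer, and passing
  between the two views costs no computation.
\<close>

class encodable =
  fixes encode :: "'a \<Rightarrow> nat"
  assumes encode_eq_iff [simp]: "encode x = encode y \<longleftrightarrow> x = y"

instantiation nat :: encodable
begin
definition encode_nat [simp]: "encode (n::nat) = n"
instance by standard simp
end

instantiation bool :: encodable
begin
definition encode_bool: "encode b = (if b then 1 else 0)"
instance by standard (auto simp: encode_bool)
end

instantiation prod :: (encodable, encodable) encodable
begin
definition encode_prod: "encode p = prod_encode (encode (fst p), encode (snd p))"
instance by standard (auto simp: encode_prod prod_eq_iff)
end

instantiation list :: (encodable) encodable
begin
definition encode_list: "encode xs = list_encode (map encode xs)"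
instance
proof
  fix xs ys :: "'a list"
  have "inj (encode :: 'a \<Rightarrow> nat)"
    by (simp add: inj_on_def)
  then show "encode xs = encode ys \<longleftrightarrow> xs = ys"
    by (simp add: encode_list list_encode_eq inj_map_eq_map)
qed
end

lemma encode_Pair [simp]: "encode (x, y) = prod_encode (encode x, encode y)"
  by (simp add: encode_prod)

lemma encode_Nil [simp]: "encode [] = 0"
  by (simp add: encode_list)

lemma encode_Cons [simp]: "encode (x # xs) = Suc (prod_encode (encode x, encode xs))"
  by (simp add: encode_list)

lemma encode_nat_list: "encode (xs :: nat list) = list_encode xs"
  by (simp add: encode_list map_idI)

text \<open>
  The code of a list bounds the number of iterations needed to traverse it.
\<close>

lemma length_le_encode: "length xs \<le> encode xs"
proof (induction xs)
  case (Cons x xs)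
  then show ?case
    using le_prod_encode_2[of "encode xs" "encode x"] by simp
qed simp

section \<open>Computable functions on encoded data\<close>

text \<open>
  The realizer is unconstrained outside \<open>D\<close>, where it may be undefined. This makes it
  possible to speak about oracle computations, which may be undefined on meaningless numbers, without
  leaving total functions of the logic.
\<close>

definition computable_on ::
  "(nat \<rightharpoonup> nat) set \<Rightarrow> 'a::encodable set \<Rightarrow> ('a \<Rightarrow> 'b::encodable) \<Rightarrow> bool" where
  "computable_on Or D f \<longleftrightarrow>
     (\<exists>g. recursive_in Or g \<and> (\<forall>x\<in>D. g (encode x) = Some (encode (f x))))"

abbreviation computable :: "(nat \<rightharpoonup> nat) set \<Rightarrow> ('a::encodable \<Rightarrow> 'b::encodable) \<Rightarrow> bool" where
  "computable Or \<equiv> computable_on Or UNIV"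

lemma computable_on_subset: "computable_on Or E f \<Longrightarrow> D \<subseteq> E \<Longrightarrow> computable_on Or D f"
  unfolding computable_on_def by blast

lemma computable_on_cong:
  "computable_on Or D f \<Longrightarrow> (\<And>x. x \<in> D \<Longrightarrow> encode (h x) = encode (f x)) \<Longrightarrow> computable_on Or D h"
  unfolding computable_on_def by (metis (full_types))

lemma computable_on_comp:
  assumes "computable_on Or D f" and "computable_on Or E g" and "\<And>x. x \<in> D \<Longrightarrow> f x \<in> E"
  shows "computable_on Or D (\<lambda>x. g (f x))"
proof -
  obtain f' g' where "recursive_in Or f'" "\<And>x. x \<in> D \<Longrightarrow> f' (encode x) = Some (encode (f x))"
    and "recursive_in Or g'" "\<And>x. x \<in> E \<Longrightarrow> g' (encode x) = Some (encode (g x))"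
    using assms(1,2) unfolding computable_on_def by blast
  then show ?thesis
    using assms(3) recursive_in.comp[of Or f' g'] unfolding computable_on_def
    by (intro exI[of _ "\<lambda>x. Option.bind (f' x) g'"]) auto
qed

lemma computable_comp: "computable Or g \<Longrightarrow> computable_on Or D f \<Longrightarrow> computable_on Or D (\<lambda>x. g (f x))"
  by (rule computable_on_comp) auto

text \<open>
  The rules follow the syntax of the function. Where a construct binds variables, the premise on its body
  concerns a function of one tuple that consists of the old argument and the bound variables. As the
  components are written as projections, resolution with these rules needs only pattern unification.
\<close>

named_theorems computable_intros

lemma computable_Pair [computable_intros]:
  assumes "computable_on Or D f" and "computable_on Or D g"
  shows "computable_on Or D (\<lambda>x. (f x, g x))"
proof -
  obtain f' g' where "recursive_in Or f'" "\<And>x. x \<in> D \<Longrightarrow> f' (encode x) = Some (encode (f x))"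
    and "recursive_in Or g'" "\<And>x. x \<in> D \<Longrightarrow> g' (encode x) = Some (encode (g x))"
    using assms unfolding computable_on_def by blast
  then show ?thesis
    using recursive_in.pair[of Or f' g'] unfolding computable_on_def by fastforce
qed

lemma computable_realizerI:
  assumes "recursive_in Or (\<lambda>n. Some (F n))" and "\<And>x. x \<in> D \<Longrightarrow> encode (f x) = F (encode x)"
  shows "computable_on Or D f"
  using assms unfolding computable_on_def by auto

lemma computable_Suc [computable_intros]:
  "computable_on Or D f \<Longrightarrow> computable_on Or D (\<lambda>x. Suc (f x))"
  by (rule computable_comp[OF computable_realizerI[OF recursive_in.succ]]) simp

lemma computable_fst [computable_intros]:
  "computable_on Or D f \<Longrightarrow> computable_on Or D (\<lambda>x. fst (f x))"
  by (rule computable_comp[OF computable_realizerI[OF recursive_in.left]]) (simp add: encode_prod)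

lemma computable_snd [computable_intros]:
  "computable_on Or D f \<Longrightarrow> computable_on Or D (\<lambda>x. snd (f x))"
  by (rule computable_comp[OF computable_realizerI[OF recursive_in.right]]) (simp add: encode_prod)

lemma computable_id [computable_intros]: "computable_on Or D (\<lambda>x. x)"
proof -
  have "recursive_in Or (\<lambda>n. Some n)"
    using recursive_in.pair[OF recursive_in.left[of Or] recursive_in.right] by simp
  then show ?thesis
    by (rule computable_realizerI) simp
qed

lemma computable_const [computable_intros]: "computable_on Or D (\<lambda>x. c)"
proof -
  have "recursive_in Or (\<lambda>x. Some n)" for n
  proof (induction n)
    case 0
    show ?case by (rule recursive_in.zero)
  next
    case (Suc n)
    then show ?case
      using recursive_in.comp[OF Suc recursive_in.succ] by simp
  qed
  then show ?thesis
    by (rule computable_realizerI) simp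
qed

text \<open>
  The step function has to be computable only at the triples that the recursion visits. The set
  \<open>E\<close> is left open so that an invariant of the recursion can be supplied for it.
\<close>

lemma computable_rec_nat_on:
  fixes s :: "'a::encodable \<Rightarrow> nat \<Rightarrow> 'b::encodable \<Rightarrow> 'b"
  assumes b: "computable_on Or D b" and n: "computable_on Or D n"
    and s: "computable_on Or E (\<lambda>z. s (fst z) (fst (snd z)) (snd (snd z)))"
    and E: "\<And>x i. x \<in> D \<Longrightarrow> i < n x \<Longrightarrow> (x, i, rec_nat (b x) (s x) i) \<in> E"
  shows "computable_on Or D (\<lambda>x. rec_nat (b x) (s x) (n x))"
proof -
  obtain b' where b': "recursive_in Or b'" "\<And>x. x \<in> D \<Longrightarrow> b' (encode x) = Some (encode (b x))"
    using b unfolding computable_on_def by blast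
  obtain s' where s': "recursive_in Or s'"
    "\<And>z. z \<in> E \<Longrightarrow> s' (encode z) = Some (encode (s (fst z) (fst (snd z)) (snd (snd z))))"
    using s unfolding computable_on_def by blast
  let ?loop = "\<lambda>a. rec_nat (b' a) (\<lambda>m acc. Option.bind acc (\<lambda>v. s' (prod_encode (a, prod_encode (m, v)))))"
  have loop: "?loop (encode x) i = Some (encode (rec_nat (b x) (s x) i))" if "x \<in> D" "i \<le> n x" for x i
    using \<open>i \<le> n x\<close>
  proof (induction i)
    case 0
    then show ?case using that b' by simp
  next
    case (Suc i)
    then show ?case
      using s'(2)[OF E[OF \<open>x \<in> D\<close>, of i]] by simp
  qed
  have "computable_on Or D (\<lambda>x. (x, n x))"
    by (intro computable_intros n)
  then obtain p where p: "recursive_in Or p" "\<And>x. x \<in> D \<Longrightarrow> p (encode x) = Some (encode (x, n x))"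
    unfolding computable_on_def by blast
  show ?thesis
    unfolding computable_on_def
  proof (intro exI conjI ballI)
    show "recursive_in Or (\<lambda>k. Option.bind (p k) (primrec_comb b' s'))"
      by (intro recursive_in.comp recursive_in.prec p b' s')
    show "Option.bind (p (encode x)) (primrec_comb b' s') = Some (encode (rec_nat (b x) (s x) (n x)))"
      if "x \<in> D" for x
      using p that loop[OF that] by (simp add: primrec_comb_def)
  qed
qed

lemma computable_rec_nat [computable_intros]:
  assumes "computable_on Or D b" and "computable_on Or D n"
    and "computable Or (\<lambda>z. s (fst z) (fst (snd z)) (snd (snd z)))"
  shows "computable_on Or D (\<lambda>x. rec_nat (b x) (s x) (n x))"
  by (rule computable_rec_nat_on[OF assms]) simp

lemma computable_of_bool [computable_intros]:
  "computable_on Or D c \<Longrightarrow> computable_on Or D (\<lambda>x. of_bool (c x) :: nat)"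
  by (erule computable_on_cong) (simp add: encode_bool)

text \<open>
  A recursion that forgets the previous value distinguishes zero from successors.
\<close>

lemma computable_eq_0: "computable_on Or D f \<Longrightarrow> computable_on Or D (\<lambda>x. f x = (0::nat))"
  by (rule computable_on_cong[where f = "\<lambda>x. rec_nat (1::nat) (\<lambda>i v. 0) (f x)"])
    (auto intro!: computable_intros simp: encode_bool gr0_conv_Suc dest!: gr0_implies_Suc)

lemma computable_Not [computable_intros]:
  "computable_on Or D c \<Longrightarrow> computable_on Or D (\<lambda>x. \<not> c x)"
  using computable_eq_0[OF computable_of_bool, of Or D c] by simp

lemma computable_pred:
  assumes "computable_on Or D f"
  shows "computable_on Or D (\<lambda>x. f x - 1 :: nat)"
proof -
  have "computable_on Or D (\<lambda>x. rec_nat (0::nat) (\<lambda>i v. i) (f x))"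
    by (intro computable_intros assms)
  moreover have "rec_nat (0::nat) (\<lambda>i v. i) n = n - 1" for n
    by (cases n) auto
  ultimately show ?thesis by simp
qed

lemma computable_diff [computable_intros]:
  assumes "computable_on Or D f" and "computable_on Or D g"
  shows "computable_on Or D (\<lambda>x. f x - g x :: nat)"
proof -
  have "rec_nat m (\<lambda>i v. v - 1) n = m - n" for m n :: nat
    by (induction n) auto
  moreover have "computable_on Or D (\<lambda>x. rec_nat (f x) (\<lambda>i v. v - 1) (g x))"
    by (intro computable_intros computable_pred assms)
  ultimately show ?thesis by simp
qed

lemma computable_less [computable_intros]:
  assumes "computable_on Or D f" and "computable_on Or D g"
  shows "computable_on Or D (\<lambda>x. f x < (g x :: nat))"
proof -
  have "computable_on Or D (\<lambda>x. \<not> g x - f x = 0)"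
    by (intro computable_intros computable_eq_0 assms)
  then show ?thesis by (simp add: not_le)
qed

text \<open>
  The branch \<open>f\<close> may be undefined where the condition fails, so it must not be evaluated there.
  A recursion of length 0 or 1 has this effect, since its step is evaluated only if the length is 1.
\<close>

lemma computable_guarded:
  assumes c: "computable_on Or D c" and f: "computable_on Or {x \<in> D. c x} f"
    and g: "computable_on Or D g"
  shows "computable_on Or D (\<lambda>x. if c x then encode (f x) else g x)"
proof -
  have "computable_on Or D (\<lambda>x. rec_nat (g x) (\<lambda>i v. encode (f x)) (of_bool (c x)))"
  proof (rule computable_rec_nat_on[OF g computable_of_bool[OF c], where E = "{x \<in> D. c x} \<times> UNIV"])
    have "computable_on Or {x \<in> D. c x} (\<lambda>x. encode (f x))"
      by (rule computable_on_cong[OF f]) simp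
    then show "computable_on Or ({x \<in> D. c x} \<times> UNIV) (\<lambda>z. encode (f (fst z)))"
      by (rule computable_on_comp[OF computable_fst[OF computable_id]]) auto
  qed (auto simp: of_bool_def split: if_splits)
  then show ?thesis
    by (rule computable_on_cong) simp
qed

text \<open>
  Both branches are protected by nesting two guards.
\<close>

lemma computable_If_on:
  assumes c: "computable_on Or D c"
    and f: "computable_on Or {x \<in> D. c x} f" and g: "computable_on Or {x \<in> D. \<not> c x} g"
  shows "computable_on Or D (\<lambda>x. if c x then f x else g x)"
proof -
  have "computable_on Or D (\<lambda>x. if \<not> c x then encode (g x) else if c x then encode (f x) else 0)"
    by (intro computable_guarded computable_Not computable_const c f g)
  then show ?thesis
    by (rule computable_on_cong) simp
qed

lemma computable_If [computable_intros]:
  assumes "computable_on Or D c" and "computable_on Or D f" and "computable_on Or D g"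
  shows "computable_on Or D (\<lambda>x. if c x then f x else g x)"
  by (rule computable_If_on[OF assms(1)]) (auto intro: assms computable_on_subset)

lemma computable_conj [computable_intros]:
  assumes "computable_on Or D c" and "computable_on Or D d"
  shows "computable_on Or D (\<lambda>x. c x \<and> d x)"
proof -
  have "computable_on Or D (\<lambda>x. if c x then d x else False)"
    by (intro computable_intros assms)
  then show ?thesis
    by (rule computable_on_cong) simp
qed

lemma computable_eq [computable_intros]:
  assumes "computable_on Or D f" and "computable_on Or D g"
  shows "computable_on Or D (\<lambda>x. f x = g x)"
proof -
  have *: "computable_on Or D (\<lambda>x. encode (f x))" "computable_on Or D (\<lambda>x. encode (g x))"
    by (auto intro: computable_on_cong[OF assms(1)] computable_on_cong[OF assms(2)])
  have "computable_on Or D (\<lambda>x. \<not> encode (f x) < encode (g x) \<and> \<not> encode (g x) < encode (f x))"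
    by (intro computable_intros *)
  then show ?thesis
  proof (rule computable_on_cong)
    fix x
    have "f x = g x \<longleftrightarrow> encode (f x) = encode (g x)"
      by simp
    also have "\<dots> \<longleftrightarrow> \<not> encode (f x) < encode (g x) \<and> \<not> encode (g x) < encode (f x)"
      by linarith
    finally show "encode (f x = g x) = encode (\<not> encode (f x) < encode (g x) \<and> \<not> encode (g x) < encode (f x))"
      by (rule arg_cong)
  qed
qed

section \<open>Computable functions on lists\<close>

lemma computable_Cons [computable_intros]:
  assumes "computable_on Or D f" and "computable_on Or D g"
  shows "computable_on Or D (\<lambda>x. f x # g x)"
proof -
  have "computable_on Or D (\<lambda>x. Suc (encode (f x, g x)))"
    by (intro computable_Suc computable_on_cong[OF computable_Pair[OF assms]]) simp
  then show ?thesis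
    by (rule computable_on_cong) simp
qed

text \<open>
  A nonempty list is encoded as the successor of the code of the pair of its head and its tail.
\<close>

lemma computable_uncons:
  assumes "computable_on Or D f" and "\<And>x. x \<in> D \<Longrightarrow> f x \<noteq> []"
  shows "computable_on Or D (\<lambda>x. (hd (f x), tl (f x)))"
proof -
  have "computable_on Or D (\<lambda>x. encode (f x) - 1)"
    by (rule computable_pred[OF computable_on_cong[OF assms(1)]]) simp
  then show ?thesis
  proof (rule computable_on_cong)
    fix x assume "x \<in> D"
    then obtain y ys where "f x = y # ys"
      using assms(2) by (cases "f x") auto
    then show "encode (hd (f x), tl (f x)) = encode (encode (f x) - 1)"
      by simp
  qed
qed

lemma computable_hd:
  "computable_on Or D f \<Longrightarrow> (\<And>x. x \<in> D \<Longrightarrow> f x \<noteq> []) \<Longrightarrow> computable_on Or D (\<lambda>x. hd (f x))"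
  using computable_fst[OF computable_uncons] by fastforce

lemma computable_tl [computable_intros]:
  assumes "computable_on Or D f"
  shows "computable_on Or D (\<lambda>x. tl (f x))"
proof -
  have "computable_on Or D (\<lambda>x. if f x = [] then [] else snd (hd (f x), tl (f x)))"
    by (intro computable_If_on computable_intros computable_snd[OF computable_uncons]
        computable_on_subset[OF assms] assms) auto
  then show ?thesis
    by (rule computable_on_cong) auto
qed

text \<open>
  The fold is a recursion on a pair consisting of the unread rest and the accumulator, which
  stays constant once the rest is empty. Hence any bound on the length of the list, such as its code, can
  serve as the number of rounds. The invariant that the rest contains only elements of the list confines the
  evaluation of \<open>f\<close> to \<open>E\<close>.
\<close>

lemma computable_fold_on:
  fixes f :: "'a::encodable \<Rightarrow> 'b::encodable \<Rightarrow> 'c::encodable \<Rightarrow> 'c"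
  assumes xs: "computable_on Or D xs" and b: "computable_on Or D b"
    and f: "computable_on Or E (\<lambda>z. f (fst z) (fst (snd z)) (snd (snd z)))"
    and E: "\<And>e x v. e \<in> D \<Longrightarrow> x \<in> set (xs e) \<Longrightarrow> (e, x, v) \<in> E"
  shows "computable_on Or D (\<lambda>e. fold (f e) (xs e) (b e))"
proof -
  define s where "s = (\<lambda>e (i::nat) st. if fst st = [] then st
     else (tl (fst st), f e (hd (fst st)) (snd st)))"
  have s_iter: "rec_nat (xs e, b e) (s e) k = (drop k (xs e), fold (f e) (take k (xs e)) (b e))" for e k
  proof (induction k)
    case (Suc k)
    show ?case
    proof (cases "k < length (xs e)")
      case True
      have "rec_nat (xs e, b e) (s e) (Suc k) = s e k (drop k (xs e), fold (f e) (take k (xs e)) (b e))"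
        by (simp add: Suc)
      also have "\<dots> = (drop (Suc k) (xs e), fold (f e) (take (Suc k) (xs e)) (b e))"
        using True
        by (simp add: s_def take_Suc_conv_app_nth drop_Suc hd_drop_conv_nth tl_drop)
      finally show ?thesis .
    next
      case False
      then show ?thesis
        using Suc by (simp add: s_def)
    qed
  qed simp
  have bound: "computable_on Or D (\<lambda>e. encode (xs e))"
    by (rule computable_on_cong[OF xs]) simp
  have "computable_on Or D (\<lambda>e. rec_nat (xs e, b e) (s e) (encode (xs e)))"
  proof (rule computable_rec_nat_on[OF computable_Pair[OF xs b] bound])
    let ?E = "{(e, i, st). e \<in> D \<and> set (fst st) \<subseteq> set (xs e)} :: ('a \<times> nat \<times> 'b list \<times> 'c) set"
    show "computable_on Or ?E (\<lambda>z. s (fst z) (fst (snd z)) (snd (snd z)))"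
      unfolding s_def
    proof (intro computable_If_on computable_Pair)
      let ?N = "{z \<in> ?E. fst (snd (snd z)) \<noteq> []}"
      have "computable_on Or ?N (\<lambda>z. (fst z, hd (fst (snd (snd z))), snd (snd (snd z))))"
        by (intro computable_intros computable_hd) auto
      moreover have "(fst z, hd (fst (snd (snd z))), snd (snd (snd z))) \<in> E" if "z \<in> ?N" for z
        using that by (intro E) (auto, meson hd_in_set subsetD)
      ultimately have "computable_on Or ?N
          (\<lambda>z. (\<lambda>z. f (fst z) (fst (snd z)) (snd (snd z))) (fst z, hd (fst (snd (snd z))), snd (snd (snd z))))"
        by (rule computable_on_comp[OF _ f])
      then show "computable_on Or ?N (\<lambda>z. f (fst z) (hd (fst (snd (snd z)))) (snd (snd (snd z))))"
        by simp
    qed (intro computable_intros)+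
    show "(e, i, rec_nat (xs e, b e) (s e) i) \<in> ?E" if "e \<in> D" for e i
      using that by (auto simp: s_iter dest: in_set_dropD)
  qed
  from computable_snd[OF this] show ?thesis
    by (rule computable_on_cong) (simp add: s_iter length_le_encode)
qed

lemma computable_fold [computable_intros]:
  assumes "computable_on Or D xs" and "computable_on Or D b"
    and "computable Or (\<lambda>z. f (fst z) (fst (snd z)) (snd (snd z)))"
  shows "computable_on Or D (\<lambda>e. fold (f e) (xs e) (b e))"
  by (rule computable_fold_on[OF assms]) simp

lemma computable_rev [computable_intros]:
  assumes "computable_on Or D xs"
  shows "computable_on Or D (\<lambda>e. rev (xs e))"
proof -
  have "computable_on Or D (\<lambda>e. fold (\<lambda>x l. x # l) (xs e) [])"
    by (intro computable_intros assms)
  then show ?thesis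
    by (simp add: fold_Cons_rev)
qed

lemma computable_foldr [computable_intros]:
  assumes "computable_on Or D xs" and "computable_on Or D b"
    and "computable Or (\<lambda>z. f (fst z) (fst (snd z)) (snd (snd z)))"
  shows "computable_on Or D (\<lambda>e. foldr (f e) (xs e) (b e))"
  unfolding foldr_conv_fold by (intro computable_intros assms)

lemma computable_map_on:
  assumes xs: "computable_on Or D xs"
    and f: "computable_on Or E (\<lambda>z. f (fst z) (snd z))"
    and E: "\<And>e x. e \<in> D \<Longrightarrow> x \<in> set (xs e) \<Longrightarrow> (e, x) \<in> E"
  shows "computable_on Or D (\<lambda>e. map (f e :: 'b::encodable \<Rightarrow> 'c::encodable) (xs e))"
proof -
  have "computable_on Or D (\<lambda>e. rev (fold (\<lambda>x l. f e x # l) (xs e) [] :: 'c list))"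
  proof (intro computable_rev computable_fold_on computable_Cons)
    let ?E = "{z. (fst z, fst (snd z)) \<in> E}"
    have "computable_on Or ?E (\<lambda>z. (fst z, fst (snd z)))"
      by (intro computable_intros)
    from computable_on_comp[OF this f]
    show "computable_on Or ?E (\<lambda>z. f (fst z) (fst (snd z)))"
      by simp
  qed (use E in \<open>auto intro!: computable_intros xs\<close>)
  moreover have "fold (\<lambda>x l. g x # l) ys zs = rev (map g ys) @ zs" for g :: "'b \<Rightarrow> 'c" and ys zs
    by (induction ys arbitrary: zs) auto
  ultimately show ?thesis
    by simp
qed

lemma computable_map [computable_intros]:
  assumes "computable_on Or D xs" and "computable Or (\<lambda>z. f (fst z) (snd z))"
  shows "computable_on Or D (\<lambda>e. map (f e) (xs e))"
  by (rule computable_map_on[OF assms]) simp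

lemma computable_length [computable_intros]:
  assumes "computable_on Or D xs"
  shows "computable_on Or D (\<lambda>e. length (xs e))"
proof -
  have "computable_on Or D (\<lambda>e. fold (\<lambda>x. Suc) (xs e) 0)"
    by (intro computable_intros assms)
  moreover have "fold (\<lambda>x. Suc) ys k = length ys + k" for ys :: "'b list" and k
    by (induction ys arbitrary: k) auto
  ultimately show ?thesis
    by simp
qed

lemma computable_append [computable_intros]:
  assumes "computable_on Or D xs" and "computable_on Or D ys"
  shows "computable_on Or D (\<lambda>e. xs e @ ys e :: 'b::encodable list)"
proof -
  have "computable_on Or D (\<lambda>e. foldr (\<lambda>x l. x # l) (xs e) (ys e))"
    by (intro computable_intros assms)
  moreover have "foldr (\<lambda>x l. x # l) us vs = us @ vs" for us vs :: "'b list"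
    by (induction us) auto
  ultimately show ?thesis
    by simp
qed

lemma computable_concat [computable_intros]:
  assumes "computable_on Or D xss"
  shows "computable_on Or D (\<lambda>e. concat (xss e))"
proof -
  have "computable_on Or D (\<lambda>e. foldr (\<lambda>x l. x @ l) (xss e) [])"
    by (intro computable_intros assms)
  then show ?thesis
    by (simp add: concat_conv_foldr)
qed

lemma computable_filter [computable_intros]:
  assumes "computable_on Or D xs" and "computable Or (\<lambda>z. P (fst z) (snd z))"
  shows "computable_on Or D (\<lambda>e. filter (P e) (xs e))"
proof -
  have "computable Or (\<lambda>z. (fst z, fst (snd z)))"
    by (intro computable_intros)
  from computable_comp[OF assms(2) this]
  have P: "computable Or (\<lambda>z. P (fst z) (fst (snd z)))"
    by simp
  have "computable_on Or D (\<lambda>e. foldr (\<lambda>x l. if P e x then x # l else l) (xs e) [])"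
    by (intro computable_intros assms P)
  moreover have "foldr (\<lambda>x l. if Q x then x # l else l) ys [] = filter Q ys" for Q and ys :: "'b list"
    by (induction ys) auto
  ultimately show ?thesis
    by simp
qed

lemma computable_list_all [computable_intros]:
  assumes "computable_on Or D xs" and "computable Or (\<lambda>z. P (fst z) (snd z))"
  shows "computable_on Or D (\<lambda>e. list_all (P e) (xs e))"
proof -
  have "computable_on Or D (\<lambda>e. filter (\<lambda>x. \<not> P e x) (xs e) = [])"
    by (intro computable_intros assms)
  then show ?thesis
    by (simp add: filter_empty_conv list_all_iff)
qed

lemma computable_upt [computable_intros]:
  assumes "computable_on Or D n"
  shows "computable_on Or D (\<lambda>e. [0..<n e])"
proof -
  have "computable_on Or D (\<lambda>e. rec_nat [] (\<lambda>i l. l @ [i]) (n e))"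
    by (intro computable_intros assms)
  moreover have "rec_nat [] (\<lambda>i l. l @ [i]) k = [0..<k]" for k
    by (induction k) auto
  ultimately show ?thesis
    by simp
qed

lemma computable_product_lists [computable_intros]:
  assumes "computable_on Or D xss"
  shows "computable_on Or D (\<lambda>e. product_lists (xss e))"
proof -
  have "computable_on Or D
      (\<lambda>e. foldr (\<lambda>xs l. concat (map (\<lambda>x. map (Cons x) l) xs)) (xss e) [[]])"
    by (intro computable_intros assms)
  moreover have "foldr (\<lambda>xs l. concat (map (\<lambda>x. map (Cons x) l) xs)) yss [[]] = product_lists yss"
    for yss :: "'b list list"
    by (induction yss) auto
  ultimately show ?thesis
    by simp
qed

text \<open>
  Total lookup, so that computability needs no condition on the index.
\<close>

definition nth_or :: "'a \<Rightarrow> 'a list \<Rightarrow> nat \<Rightarrow> 'a" where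
  "nth_or d xs i = (if i < length xs then xs ! i else d)"

lemma computable_nth_or [computable_intros]:
  assumes "computable_on Or D d" "computable_on Or D xs" and "computable_on Or D i"
  shows "computable_on Or D (\<lambda>e. nth_or (d e) (xs e) (i e))"
proof -
  have drop: "computable_on Or D (\<lambda>e. rec_nat (xs e) (\<lambda>k. tl) (i e))"
    by (intro computable_intros assms)
  have [simp]: "rec_nat ys (\<lambda>k. tl) j = drop j ys" for ys :: "'b list" and j
    by (induction j) (auto simp: drop_Suc tl_drop)
  have "computable_on Or D (\<lambda>e. if i e < length (xs e) then hd (drop (i e) (xs e)) else d e)"
    by (intro computable_If_on computable_hd computable_on_subset[OF drop[simplified]]
        computable_on_subset[OF assms(1)] computable_intros assms) auto
  then show ?thesis
    by (rule computable_on_cong) (auto simp: nth_or_def hd_drop_conv_nth)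
qed

lemma computable_list_encode [computable_intros]:
  "computable_on Or D f \<Longrightarrow> computable_on Or D (\<lambda>e. list_encode (f e))"
  by (erule computable_on_cong) (simp add: encode_nat_list)

lemma computable_list_decode [computable_intros]:
  "computable_on Or D f \<Longrightarrow> computable_on Or D (\<lambda>e. list_decode (f e))"
  by (erule computable_on_cong) (simp add: encode_nat_list)

lemma computable_encode [computable_intros]:
  "computable_on Or D f \<Longrightarrow> computable_on Or D (\<lambda>e. encode (f e))"
  by (erule computable_on_cong) simp

section \<open>Deterministic automata\<close>

definition dfa ::
  "nat \<Rightarrow> 'q::encodable list \<Rightarrow> 'q \<Rightarrow> (nat \<Rightarrow> 'q \<Rightarrow> 'q) \<Rightarrow> ('q \<Rightarrow> bool) \<Rightarrow> automaton" where
  "dfa r Q q \<delta> F =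
     \<lparr>states = map encode Q, initials = [encode q],
      transitions = concat (map (\<lambda>s. map (\<lambda>a. (encode s, a, encode (\<delta> a s))) [0..<r]) Q),
      finals = map encode (filter F Q)\<rparr>"

text \<open>
  Since \<open>Q\<close> is closed under \<open>\<delta>\<close> and encoding is injective, the runs of the
  automaton are exactly the iterations of \<open>\<delta>\<close>.
\<close>

lemma
  assumes q: "q \<in> set Q" and \<delta>: "\<And>a s. a < r \<Longrightarrow> s \<in> set Q \<Longrightarrow> \<delta> a s \<in> set Q"
  shows finite_automaton_dfa: "finite_automaton r (dfa r Q q \<delta> F)"
    and recognized_dfa: "recognized (dfa r Q q \<delta> F) = {w \<in> lists {..<r}. F (fold \<delta> w q)}"
proof -
  show "finite_automaton r (dfa r Q q \<delta> F)"
    using assms by (auto simp: finite_automaton_def dfa_def)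
  let ?T = "set (transitions (dfa r Q q \<delta> F))"
  have step: "(encode s, a, t) \<in> ?T \<longleftrightarrow> a < r \<and> t = encode (\<delta> a s)" if "s \<in> set Q" for s a t
    using that by (auto simp: dfa_def intro!: bexI[of _ s])
  have run: "run ?T (encode s) w t \<longleftrightarrow> w \<in> lists {..<r} \<and> t = encode (fold \<delta> w s)"
    if "s \<in> set Q" for s w t
    using that
  proof (induction w arbitrary: s)
    case (Cons a w)
    then show ?case
      by (auto simp: step \<delta>)
  qed auto
  have "fold \<delta> w s \<in> set Q" if "s \<in> set Q" "w \<in> lists {..<r}" for s w
    using that by (induction w arbitrary: s) (auto simp: \<delta>)
  moreover have "recognized (dfa r Q q \<delta> F) =
      {w. \<exists>s\<in>set Q. F s \<and> run ?T (encode q) w (encode s)}"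
    by (auto simp: recognized_def dfa_def)
  ultimately show "recognized (dfa r Q q \<delta> F) = {w \<in> lists {..<r}. F (fold \<delta> w q)}"
    using q by (auto simp: run)
qed

lemma computable_dfa:
  assumes "computable_on Or D r" and "computable_on Or D Q" and "computable_on Or D q"
    and \<delta>: "computable Or (\<lambda>z. \<delta> (fst z) (fst (snd z)) (snd (snd z)))"
    and F: "computable Or (\<lambda>z. F (fst z) (snd z))"
  shows "computable_on Or D (\<lambda>e. automaton_code (dfa (r e) (Q e) (q e) (\<delta> e) (F e)))"
proof -
  have code: "automaton_code (dfa r Q q \<delta> F) =
      list_encode
        [list_encode (map encode Q), list_encode [encode q],
         list_encode (concat (map (\<lambda>s.
            map (\<lambda>a. list_encode [encode s, a, encode (\<delta> a s)]) [0..<r]) Q)),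
         list_encode (map encode (filter F Q))]" for r q \<delta> F and Q :: "'b list"
    by (simp add: automaton_code_def dfa_def map_concat o_def)
  have "computable Or (\<lambda>z. (fst (fst z), snd z, snd (fst z)))"
    by (intro computable_intros)
  from computable_comp[OF \<delta> this]
  have \<delta>': "computable Or (\<lambda>z. \<delta> (fst (fst z)) (snd z) (snd (fst z)))"
    by simp
  have r: "computable_on Or (D \<times> UNIV) (\<lambda>z. r (fst z))"
    by (rule computable_on_comp[OF _ assms(1)]) (auto intro: computable_intros)
  have trans: "computable_on Or D (\<lambda>e. concat (map (\<lambda>s.
      map (\<lambda>a. list_encode [encode s, a, encode (\<delta> e a s)]) [0..<r e]) (Q e)))"
  proof (intro computable_concat computable_map_on[OF assms(2)])
    show "computable_on Or (D \<times> UNIV) (\<lambda>z.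
        map (\<lambda>a. list_encode [encode (snd z), a, encode (\<delta> (fst z) a (snd z))]) [0..<r (fst z)])"
      by (intro computable_intros r \<delta>')
  qed simp
  show ?thesis
    unfolding code
    by (intro trans assms(2,3) F computable_list_encode computable_Cons computable_const
        computable_map computable_filter computable_encode computable_snd computable_id)
qed

section \<open>Operation tables\<close>

text \<open>
  Tables are indexed by positions in a list of elements that may contain repetitions. The first
  occurrence is as good as any other, because the entries of a table depend only on the elements.
\<close>

definition position :: "'a list \<Rightarrow> 'a \<Rightarrow> nat" where
  "position xs x = length (takeWhile (\<lambda>y. y \<noteq> x) xs)"

lemma position:
  assumes "x \<in> set xs"
  shows position_less: "position xs x < length xs" and nth_position: "xs ! position xs x = x"
proof -
  show "position xs x < length xs"
    using assms unfolding position_def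
    by (metis (mono_tags, lifting) length_takeWhile_le le_neq_implies_less takeWhile_eq_all_conv
        takeWhile_eq_take take_all_iff order_refl)
  then show "xs ! position xs x = x"
    using nth_length_takeWhile[of "\<lambda>y. y \<noteq> x" xs] unfolding position_def by simp
qed

lemma computable_position [computable_intros]:
  assumes "computable_on Or D xs" and "computable_on Or D x"
  shows "computable_on Or D (\<lambda>e. position (xs e) (x e))"
proof -
  (* Prefixing an element to takeWhile restarts the result if the element is the one sought. The list
     is read from its end, and the element sought is carried in the accumulator. *)
  have "computable_on Or D (\<lambda>e. length (snd (fold
      (\<lambda>y s. (fst s, if y = fst s then [] else y # snd s)) (rev (xs e)) (x e, []))))"
    by (intro computable_intros assms)
  moreover have "fold (\<lambda>y s. (fst s, if y = fst s then [] else y # snd s)) (rev ys) (y, []) =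
      (y, takeWhile (\<lambda>z. z \<noteq> y) ys)" for ys :: "'b list" and y
    by (induction ys) auto
  ultimately show ?thesis
    by (simp add: position_def)
qed

definition table_lookup :: "nat list \<Rightarrow> nat list list \<Rightarrow> nat \<Rightarrow> nat \<Rightarrow> nat" where
  "table_lookup es tab x y = nth_or 0 (nth_or [] tab (position es x)) (position es y)"

lemma table_lookup:
  "x \<in> set es \<Longrightarrow> y \<in> set es \<Longrightarrow> table_lookup es (map (\<lambda>x. map (f x) es) es) x y = f x y"
  by (simp add: table_lookup_def nth_or_def position_less nth_position)

lemma computable_table_lookup [computable_intros]:
  assumes "computable_on Or D es" "computable_on Or D tab" "computable_on Or D x" "computable_on Or D y"
  shows "computable_on Or D (\<lambda>e. table_lookup (es e) (tab e) (x e) (y e))"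
  unfolding table_lookup_def by (intro computable_intros assms)

section \<open>Machines that evaluate a product over a finite semiring\<close>

text \<open>
  The elements of a finite semiring, followed by its addition and its multiplication table.
\<close>

type_synonym tables = "nat list \<times> nat list list \<times> nat list list"

text \<open>
  The sum of the products \<open>v\<^sub>i c\<^sub>i\<close> for \<open>i < n\<close>, where \<open>z\<close> stands for zero.
\<close>

definition dot :: "tables \<Rightarrow> nat \<Rightarrow> nat list \<Rightarrow> nat list \<Rightarrow> nat \<Rightarrow> nat" where
  "dot T z v c n =
     fold (\<lambda>i s. table_lookup (fst T) (fst (snd T)) s
                   (table_lookup (fst T) (snd (snd T)) (nth_or 0 v i) (nth_or 0 c i)))
       [0..<n] z"

definition row_mult :: "tables \<Rightarrow> nat \<Rightarrow> nat \<Rightarrow> nat list \<Rightarrow> nat list list \<Rightarrow> nat list" where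
  "row_mult T z n v A = map (\<lambda>j. dot T z v (map (\<lambda>row. nth_or 0 row j) A) n) [0..<n]"

text \<open>
  A machine decides one scalar test. Its components are the tables of a finite semiring, the zero
  of that semiring, the dimension, the matrices of the letters, the final column and the required
  value. A state of the machine is the machine itself together with a row. Carrying
  the constant part along makes the transition function independent of the test, so that a list of states of
  different machines can be advanced by one and the same function.
\<close>

type_synonym machine =
  "tables \<times> nat \<times> nat \<times> nat list list list \<times> nat list \<times> nat"

definition machine_step :: "nat \<Rightarrow> machine \<times> nat list \<Rightarrow> machine \<times> nat list" where
  "machine_step = (\<lambda>a ((T, z, n, \<mu>s, b, g), v). ((T, z, n, \<mu>s, b, g), row_mult T z n v (nth_or [] \<mu>s a)))"

definition machine_accepts :: "machine \<times> nat list \<Rightarrow> bool" where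
  "machine_accepts = (\<lambda>((T, z, n, \<mu>s, b, g), v). dot T z v b n = g)"

definition machine_states :: "machine \<Rightarrow> (machine \<times> nat list) list" where
  "machine_states = (\<lambda>(T, z, n, \<mu>s, b, g).
     map (\<lambda>v. ((T, z, n, \<mu>s, b, g), v)) (product_lists (map (\<lambda>_. fst T) [0..<n])))"

text \<open>
  The product automaton of several machines. The initial states already contain the machines,
  hence also all states that can occur.
\<close>

definition parallel :: "nat \<Rightarrow> (machine \<times> nat list) list \<Rightarrow> automaton" where
  "parallel r ss = dfa r (product_lists (map (\<lambda>s. machine_states (fst s)) ss)) ss
     (\<lambda>a. map (machine_step a)) (list_all machine_accepts)"

lemma computable_dot [computable_intros]:
  assumes "computable_on Or D T" "computable_on Or D z" "computable_on Or D v"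
    "computable_on Or D c" "computable_on Or D n"
  shows "computable_on Or D (\<lambda>e. dot (T e) (z e) (v e) (c e) (n e))"
proof -
  have "computable Or (\<lambda>(T, z, v, c, n). dot T z v c n)"
    unfolding dot_def case_prod_unfold by (intro computable_intros)
  from computable_comp[OF this, of D "\<lambda>e. (T e, z e, v e, c e, n e)"] show ?thesis
    by (simp add: computable_Pair assms)
qed

lemma computable_row_mult [computable_intros]:
  assumes "computable_on Or D T" "computable_on Or D z" "computable_on Or D n"
    "computable_on Or D v" "computable_on Or D A"
  shows "computable_on Or D (\<lambda>e. row_mult (T e) (z e) (n e) (v e) (A e))"
proof -
  have "computable Or (\<lambda>(T, z, n, v, A). row_mult T z n v A)"
    unfolding row_mult_def case_prod_unfold by (intro computable_intros)
  from computable_comp[OF this, of D "\<lambda>e. (T e, z e, n e, v e, A e)"] show ?thesis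
    by (simp add: computable_Pair assms)
qed

lemma computable_parallel:
  assumes "computable_on Or D r" "computable_on Or D ss"
  shows "computable_on Or D (\<lambda>e. automaton_code (parallel (r e) (ss e)))"
  unfolding parallel_def machine_states_def machine_step_def machine_accepts_def case_prod_unfold
  by (rule computable_dfa; intro computable_intros assms)

definition entry_row :: "('s \<Rightarrow> nat) \<Rightarrow> nat \<Rightarrow> 's mat \<Rightarrow> nat list" where
  "entry_row h n X = map (\<lambda>i. h (X $$ (0, i))) [0..<n]"

section \<open>Correctness of the machines\<close>

lemma mult_mat_entry:
  assumes "A \<in> carrier_mat k n" and "B \<in> carrier_mat n m" and "i < k" and "j < m"
  shows "(A * B) $$ (i, j) = (\<Sum>l<n. A $$ (i, l) * B $$ (l, j))"
  using assms by (simp add: scalar_prod_def atLeast0LessThan)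

lemma mat_mult_one:
  assumes "A \<in> carrier_mat k n"
  shows "A * 1\<^sub>m n = (A :: 's::{semiring_0,monoid_mult} mat)"
proof (rule eq_matI)
  fix i j assume "i < dim_row A" "j < dim_col A"
  then show "(A * 1\<^sub>m n) $$ (i, j) = A $$ (i, j)"
    using assms by (subst mult_mat_entry[OF assms one_carrier_mat])
      (auto simp: if_distrib[of "\<lambda>x. _ * x"] sum.delta' cong: if_cong)
qed (use assms in auto)

lemma set_product_lists_replicate:
  "set (product_lists (map (\<lambda>_. xs) [0..<n])) = {v. length v = n \<and> set v \<subseteq> set xs}"
proof -
  have "set v \<subseteq> set xs \<longleftrightarrow> (\<forall>i<length v. v ! i \<in> set xs)" for v
    using all_set_conv_all_nth[of v "\<lambda>x. x \<in> set xs"] by (simp add: subset_eq)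
  then show ?thesis
    by (auto simp: product_lists_set list_all2_conv_all_nth)
qed

text \<open>
  A morphism \<open>h\<close> into a finite semiring \<open>R\<close> which is given by tables. The
  list \<open>es\<close> comprises all elements of \<open>R\<close>, whether or not they are images under \<open>h\<close>.
\<close>

locale finite_image =
  fixes R :: "nat ring" and h :: "'s::{semiring_0,monoid_mult} \<Rightarrow> nat" and es :: "nat list"
    and T :: tables
  assumes R: "semiring R" and h: "semiring_morphism h R" and es: "set es = carrier R"
    and T: "T = (es, map (\<lambda>x. map (\<lambda>y. x \<oplus>\<^bsub>R\<^esub> y) es) es, map (\<lambda>x. map (\<lambda>y. x \<otimes>\<^bsub>R\<^esub> y) es) es)"
begin

lemma h_es: "h x \<in> set es"
  using h es by (simp add: semiring_morphism_def)

lemma table_add: "table_lookup es (fst (snd T)) (h x) (h y) = h (x + y)"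
  using h by (simp add: T table_lookup h_es semiring_morphism_def)

lemma table_mult: "table_lookup es (snd (snd T)) (h x) (h y) = h (x * y)"
  using h by (simp add: T table_lookup h_es semiring_morphism_def)

text \<open>
  Closure is needed for arbitrary elements of \<open>R\<close>, not only for images under \<open>h\<close>,
  because the states of the automaton range over all rows with entries in \<open>R\<close>.
\<close>

lemma dot_closed:
  assumes "set v \<subseteq> set es" and "set c \<subseteq> set es" and "n \<le> length v" and "n \<le> length c"
  shows "dot T (h 0) v c n \<in> set es"
  using assms(3,4)
proof (induction n)
  case 0
  then show ?case by (simp add: dot_def h_es)
next
  case (Suc n)
  interpret semiring R by (rule R)
  have *: "v ! n \<in> set es" "c ! n \<in> set es"
    using Suc.prems assms by auto
  with Suc show ?case
    by (simp add: dot_def T table_lookup nth_or_def es)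
qed

lemma dot_image:
  assumes "A \<in> carrier_mat k n" and "B \<in> carrier_mat n m" and "i < k" and "j < m"
    and "v = map (\<lambda>l. h (A $$ (i, l))) [0..<n]" and "c = map (\<lambda>l. h (B $$ (l, j))) [0..<n]"
  shows "dot T (h 0) v c n = h ((A * B) $$ (i, j))"
proof -
  have "p \<le> n \<Longrightarrow> fold (\<lambda>i s. table_lookup (fst T) (fst (snd T)) s
          (table_lookup (fst T) (snd (snd T)) (nth_or 0 v i) (nth_or 0 c i))) [0..<p] (h 0)
      = h (\<Sum>l<p. A $$ (i, l) * B $$ (l, j))" for p
  proof (induction p)
    case (Suc p)
    then show ?case
      using table_add table_mult assms by (simp add: nth_or_def T)
  qed simp
  from this[of n] show ?thesis
    by (simp add: dot_def mult_mat_entry[OF assms(1-4)] del: index_mult_mat)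
qed

lemma row_mult_image:
  assumes "X \<in> carrier_mat 1 n" and "A \<in> carrier_mat n n"
  shows "row_mult T (h 0) n (entry_row h n X) (map (map h) (mat_to_list A)) = entry_row h n (X * A)"
proof -
  have "map (\<lambda>row. nth_or 0 row j) (map (map h) (mat_to_list A)) = map (\<lambda>l. h (A $$ (l, j))) [0..<n]"
    if "j < n" for j
    using assms that by (simp add: mat_to_list_def nth_or_def)
  then have "dot T (h 0) (entry_row h n X) (map (\<lambda>row. nth_or 0 row j) (map (map h) (mat_to_list A))) n =
      h ((X * A) $$ (0, j))" if "j < n" for j
    using that by (intro dot_image[OF assms]) (simp_all add: entry_row_def)
  then show ?thesis
    by (simp add: row_mult_def entry_row_def)
qed

lemma row_mult_closed:
  assumes "set v \<subseteq> set es" and "length v = n" and "A \<in> carrier_mat n n"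
  shows "set (row_mult T (h 0) n v (map (map h) (mat_to_list A))) \<subseteq> set es"
proof -
  have "dot T (h 0) v (map (\<lambda>row. nth_or 0 row j) (map (map h) (mat_to_list A))) n \<in> set es"
    if "j < n" for j
    using assms that by (intro dot_closed) (auto simp: mat_to_list_def nth_or_def h_es)
  then show ?thesis
    by (auto simp: row_mult_def)
qed

definition machine_for :: "nat \<Rightarrow> nat \<Rightarrow> (nat list \<Rightarrow> 's mat) \<Rightarrow> 's mat \<Rightarrow> 's \<Rightarrow> machine" where
  "machine_for r n \<mu> \<beta> \<gamma> =
     (T, h 0, n, map (\<lambda>a. map (map h) (mat_to_list (\<mu> [a]))) [0..<r],
      map (\<lambda>i. h (\<beta> $$ (i, 0))) [0..<n], h \<gamma>)"

context
  fixes r n and \<mu> :: "nat list \<Rightarrow> 's mat" and \<beta> :: "'s mat" and \<gamma> :: 's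
  assumes \<mu>: "matrix_morphism r n \<mu>" and \<beta>: "\<beta> \<in> carrier_mat n 1"
    and \<gamma>: "h -` {h \<gamma>} = {\<gamma>}"
begin

lemma letter_carrier: "a < r \<Longrightarrow> \<mu> [a] \<in> carrier_mat n n"
  using \<mu> by (simp add: matrix_morphism_def)

lemma machine_states_machine_for:
  "s \<in> set (machine_states (machine_for r n \<mu> \<beta> \<gamma>)) \<longleftrightarrow>
    fst s = machine_for r n \<mu> \<beta> \<gamma> \<and> length (snd s) = n \<and> set (snd s) \<subseteq> set es"
proof -
  have "fst T = es"
    by (simp add: T)
  then show ?thesis
    by (cases s) (auto simp: machine_states_def machine_for_def set_product_lists_replicate)
qed

lemma machine_step_closed:
  assumes "a < r" and "s \<in> set (machine_states (machine_for r n \<mu> \<beta> \<gamma>))"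
  shows "machine_step a s \<in> set (machine_states (machine_for r n \<mu> \<beta> \<gamma>))"
proof -
  obtain v where s: "s = (machine_for r n \<mu> \<beta> \<gamma>, v)" "length v = n" "set v \<subseteq> set es"
    using assms(2) unfolding machine_states_machine_for by (cases s) auto
  have "machine_step a s = (machine_for r n \<mu> \<beta> \<gamma>, row_mult T (h 0) n v (map (map h) (mat_to_list (\<mu> [a]))))"
    using \<open>a < r\<close> by (simp add: s machine_step_def machine_for_def nth_or_def)
  moreover have "length (row_mult T (h 0) n v (map (map h) (mat_to_list (\<mu> [a])))) = n"
    by (simp add: row_mult_def)
  ultimately show ?thesis
    using row_mult_closed[OF s(3,2) letter_carrier[OF \<open>a < r\<close>]] by (simp add: machine_states_machine_for)
qed

lemma machine_start:
  "(machine_for r n \<mu> \<beta> \<gamma>, entry_row h n X) \<in> set (machine_states (machine_for r n \<mu> \<beta> \<gamma>))"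
  by (auto simp: machine_states_machine_for entry_row_def h_es)

text \<open>
  The row carried by the machine is the image of the row obtained over the original semiring. In the step, the
  letter is absorbed into the row from the right, whence the generalization over \<open>X\<close>.
\<close>

lemma machine_run:
  assumes "w \<in> lists {..<r}" and "X \<in> carrier_mat 1 n"
  shows "fold machine_step w (machine_for r n \<mu> \<beta> \<gamma>, entry_row h n X) =
    (machine_for r n \<mu> \<beta> \<gamma>, entry_row h n (X * \<mu> w))"
  using assms
proof (induction w arbitrary: X rule: list.induct)
  case Nil
  then show ?case
    using \<mu> by (simp add: matrix_morphism_def mat_mult_one)
next
  case (Cons a w)
  then have a: "a < r" and w: "w \<in> lists {..<r}"
    by auto
  have "[a] \<in> lists {..<r}"
    using a by simp
  then have "\<mu> ([a] @ w) = \<mu> [a] * \<mu> w" and w_carrier: "\<mu> w \<in> carrier_mat n n"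
    using \<mu> w unfolding matrix_morphism_def by blast+
  then have "X * \<mu> (a # w) = (X * \<mu> [a]) * \<mu> w"
    using assoc_mult_mat[OF Cons.prems(2) letter_carrier[OF a] w_carrier] by simp
  moreover have "machine_step a (machine_for r n \<mu> \<beta> \<gamma>, entry_row h n X) =
      (machine_for r n \<mu> \<beta> \<gamma>, entry_row h n (X * \<mu> [a]))"
    using a row_mult_image[OF Cons.prems(2) letter_carrier[OF a]]
    by (simp add: machine_step_def machine_for_def nth_or_def)
  moreover have "X * \<mu> [a] \<in> carrier_mat 1 n"
    using Cons.prems(2) letter_carrier[OF a] by simp
  ultimately show ?case
    using Cons.IH[OF w, of "X * \<mu> [a]"] by simp
qed

text \<open>
  This is where the separation of \<open>\<gamma>\<close> from all other elements is used.
\<close>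

lemma machine_accepts_iff:
  assumes "X \<in> carrier_mat 1 n"
  shows "machine_accepts (machine_for r n \<mu> \<beta> \<gamma>, entry_row h n X) \<longleftrightarrow> (X * \<beta>) $$ (0, 0) = \<gamma>"
proof -
  have "dot T (h 0) (entry_row h n X) (map (\<lambda>i. h (\<beta> $$ (i, 0))) [0..<n]) n = h ((X * \<beta>) $$ (0, 0))"
    using assms \<beta> by (intro dot_image) (auto simp: entry_row_def)
  then show ?thesis
    using \<gamma> by (auto simp: machine_accepts_def machine_for_def)
qed

end

end

lemma parallel_correct:
  assumes closed: "\<And>a s t. a < r \<Longrightarrow> s \<in> set ss \<Longrightarrow> t \<in> set (machine_states (fst s)) \<Longrightarrow>
      machine_step a t \<in> set (machine_states (fst s))"
    and start: "\<And>s. s \<in> set ss \<Longrightarrow> s \<in> set (machine_states (fst s))"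
  shows "finite_automaton r (parallel r ss)"
    and "recognized (parallel r ss) =
      {w \<in> lists {..<r}. \<forall>s\<in>set ss. machine_accepts (fold machine_step w s)}"
proof -
  let ?Q = "product_lists (map (\<lambda>s. machine_states (fst s)) ss)"
  have fold: "fold (\<lambda>a. map (machine_step a)) w ts = map (fold machine_step w) ts" for w ts
    by (induction w arbitrary: ts) (auto simp: o_def)
  have Q: "ts \<in> set ?Q \<longleftrightarrow> list_all2 (\<lambda>t s. t \<in> set (machine_states (fst s))) ts ss" for ts
    by (auto simp: product_lists_set list_all2_map2)
  have "ss \<in> set ?Q"
    unfolding Q by (auto simp: list_all2_same start)
  moreover have "map (machine_step a) ts \<in> set ?Q" if "a < r" "ts \<in> set ?Q" for a ts
    using that unfolding Q by (auto simp: list_all2_conv_all_nth closed)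
  ultimately show "finite_automaton r (parallel r ss)" and "recognized (parallel r ss) =
      {w \<in> lists {..<r}. \<forall>s\<in>set ss. machine_accepts (fold machine_step w s)}"
    unfolding parallel_def
    by (simp_all add: finite_automaton_dfa recognized_dfa fold list_all_iff)
qed

section \<open>Compiling finite families of scalar tests\<close>

definition decode_mat :: "nat \<Rightarrow> nat list list" where
  "decode_mat k = map list_decode (list_decode k)"

lemma computable_decode_mat [computable_intros]:
  "computable_on Or D f \<Longrightarrow> computable_on Or D (\<lambda>e. decode_mat (f e))"
  unfolding decode_mat_def by (intro computable_intros)

lemma decode_mat_op_table [simp]: "decode_mat (op_table es f) = map (\<lambda>x. map (f x) es) es"
  by (simp add: decode_mat_def op_table_def o_def)

lemma codes_matrix_entries:
  assumes "codes_matrix repr k A" and "A \<in> carrier_mat m n"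
  shows "length (decode_mat k) = m"
    and "i < m \<Longrightarrow> length (decode_mat k ! i) = n"
    and "i < m \<Longrightarrow> j < n \<Longrightarrow> repr (decode_mat k ! i ! j) = Some (A $$ (i, j))"
  using assms by (auto simp: codes_matrix_def decode_mat_def mat_to_list_def list_all2_conv_all_nth)

text \<open>
  Every element has a code, hence so has every finite object. The rationality statement, which does not mention
  codes, is thereby reduced to the constructibility statements.
\<close>

lemma codes_matrix_exists:
  assumes "\<forall>x. \<exists>c. repr c = Some x"
  shows "\<exists>k. codes_matrix repr k A"
proof -
  obtain c where c: "\<And>x. repr (c x) = Some x"
    using assms by metis
  have "codes_matrix repr (list_encode (map list_encode (map (map c) (mat_to_list A)))) A"
    by (simp add: codes_matrix_def o_def list_all2_map1 list_all2_same c)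
  then show ?thesis ..
qed

lemma codes_morphism_exists:
  assumes "\<forall>x. \<exists>c. repr c = Some x"
  shows "\<exists>k. codes_morphism repr r k \<mu>"
proof -
  obtain K where K: "\<And>A. codes_matrix repr (K A) A"
    using codes_matrix_exists[OF assms] by metis
  have "codes_morphism repr r (list_encode (map (\<lambda>a. K (\<mu> [a])) [0..<r])) \<mu>"
    by (simp add: codes_morphism_def list_all2_map1 list_all2_map2 list_all2_same K)
  then show ?thesis ..
qed

definition decode_tables :: "nat \<Rightarrow> tables" where
  "decode_tables k =
    (list_decode (nth_or 0 (list_decode k) 0),
     decode_mat (nth_or 0 (list_decode k) 1), decode_mat (nth_or 0 (list_decode k) 2))"

lemma computable_decode_tables [computable_intros]:
  "computable_on Or D f \<Longrightarrow> computable_on Or D (\<lambda>e. decode_tables (f e))"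
  unfolding decode_tables_def by (intro computable_intros)

lemma codes_tables_finite_image:
  assumes "codes_tables k R" and "semiring R" and "semiring_morphism h R"
  shows "\<exists>es. finite_image R h es (decode_tables k)"
proof -
  obtain es where "set es = carrier R" "k = list_encode [list_encode es,
      op_table es (\<lambda>x y. x \<oplus>\<^bsub>R\<^esub> y), op_table es (\<lambda>x y. x \<otimes>\<^bsub>R\<^esub> y)]"
    using assms(1) unfolding codes_tables_def by blast
  then have "finite_image R h es (decode_tables k)"
    using assms(2,3) by (simp add: finite_image_def decode_tables_def nth_or_def)
  then show ?thesis ..
qed

text \<open>
  Codes of the row \<open>\<alpha>\<close>, the column \<open>\<beta>\<close> and the value \<open>\<gamma>\<close> of a
  scalar test.
\<close>

type_synonym test = "nat list \<times> nat list \<times> nat"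

text \<open>
  All oracle computations happen here: \<open>tab g\<close> yields the tables of the semiring that separates
  the element with code \<open>g\<close>, and \<open>img g c\<close> the image in it of the element with code
  \<open>c\<close>. The zero of the finite semiring is found as the image of zero, whose code is \<open>c0\<close>.
\<close>

definition start_state ::
  "(nat \<Rightarrow> nat) \<Rightarrow> (nat \<Rightarrow> nat \<Rightarrow> nat) \<Rightarrow> nat \<Rightarrow> nat \<Rightarrow> nat list list list \<Rightarrow> test \<Rightarrow>
    machine \<times> nat list" where
  "start_state tab img c0 n cs = (\<lambda>(a, b, g).
     ((decode_tables (tab g), img g c0, n, map (map (map (img g))) cs, map (img g) b, img g g),
      map (img g) a))"

text \<open>
  The form of the conclusion matches that of the premise, so that the rule can be iterated for lists of
  rows and lists of matrices.
\<close>

lemma computable_map_lists: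
  assumes "computable_on Or (A \<times> B) (\<lambda>z. f (fst z) (snd z))"
  shows "computable_on Or (A \<times> lists B) (\<lambda>z. map (f (fst z)) (snd z))"
proof (rule computable_map_on)
  have "computable_on Or ((A \<times> lists B) \<times> B) (\<lambda>z. (fst (fst z), snd z))"
    by (intro computable_intros)
  then have "computable_on Or ((A \<times> lists B) \<times> B) (\<lambda>z. (\<lambda>z. f (fst z) (snd z)) (fst (fst z), snd z))"
    by (rule computable_on_comp[OF _ assms]) auto
  then show "computable_on Or ((A \<times> lists B) \<times> B) (\<lambda>z. f (fst (fst z)) (snd z))"
    by simp
qed (auto intro: computable_intros)

lemma computable_start_state:
  assumes tab: "computable_on Or V tab" and img: "computable_on Or (V \<times> V) (\<lambda>z. img (fst z) (snd z))"
    and c0: "c0 \<in> V"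
  shows "computable_on Or ((UNIV \<times> lists (lists (lists V))) \<times> (lists V \<times> lists V \<times> V))
    (\<lambda>z. start_state tab img c0 (fst (fst z)) (snd (fst z)) (snd z))"
    (is "computable_on Or ?D _")
proof -
  have g: "computable_on Or ?D (\<lambda>z. snd (snd (snd z)))"
    by (intro computable_intros)
  note img1 = computable_map_lists[OF img]
  note img3 = computable_map_lists[OF computable_map_lists[OF img1]]
  have "computable_on Or ?D (\<lambda>z. tab (snd (snd (snd z))))"
    by (rule computable_on_comp[OF g tab]) auto
  moreover have "computable_on Or ?D (\<lambda>z. img (snd (snd (snd z))) c0)"
    using computable_on_comp[OF computable_Pair[OF g computable_const[of Or _ c0]] img] c0 by auto
  moreover have "computable_on Or ?D (\<lambda>z. map (map (map (img (snd (snd (snd z)))))) (snd (fst z)))"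
    using computable_on_comp[OF computable_Pair[OF g computable_snd[OF computable_fst[OF computable_id]]] img3]
    by auto
  moreover have "computable_on Or ?D (\<lambda>z. map (img (snd (snd (snd z)))) (fst (snd (snd z))))"
    using computable_on_comp[OF computable_Pair[OF g computable_fst[OF computable_snd[OF computable_snd[OF computable_id]]]] img1]
    by auto
  moreover have "computable_on Or ?D (\<lambda>z. img (snd (snd (snd z))) (snd (snd (snd z))))"
    using computable_on_comp[OF computable_Pair[OF g g] img] by auto
  moreover have "computable_on Or ?D (\<lambda>z. map (img (snd (snd (snd z)))) (fst (snd z)))"
    using computable_on_comp[OF computable_Pair[OF g computable_fst[OF computable_snd[OF computable_id]]] img1]
    by auto
  ultimately show ?thesis
    unfolding start_state_def case_prod_unfold
    by (intro computable_Pair computable_decode_tables computable_fst[OF computable_fst[OF computable_id]])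
qed

definition represents_test ::
  "(nat \<Rightarrow> 's option) \<Rightarrow> nat \<Rightarrow> test \<Rightarrow> 's mat \<times> 's mat \<times> 's \<Rightarrow> bool" where
  "represents_test repr n = (\<lambda>(a, b, g) (\<alpha>, \<beta>, \<gamma>).
     \<alpha> \<in> carrier_mat 1 n \<and> \<beta> \<in> carrier_mat n 1 \<and> length a = n \<and> length b = n \<and>
     (\<forall>i<n. repr (a ! i) = Some (\<alpha> $$ (0, i))) \<and> (\<forall>i<n. repr (b ! i) = Some (\<beta> $$ (i, 0))) \<and>
     repr g = Some \<gamma>)"

text \<open>
  The alphabet size, the dimension, the codes of the matrices of the letters, and a list of tests.
\<close>

type_synonym problem = "nat \<times> (nat \<times> nat list list list) \<times> test list"

definition represents_problem ::
  "(nat \<Rightarrow> 's::{semiring_0,monoid_mult} option) \<Rightarrow> problem \<Rightarrow> nat \<Rightarrow> nat \<Rightarrow>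
    (nat list \<Rightarrow> 's mat) \<Rightarrow> ('s mat \<times> 's mat \<times> 's) list \<Rightarrow> bool" where
  "represents_problem repr = (\<lambda>(r', (n', cs), ts) r n \<mu> tests.
     r' = r \<and> n' = n \<and> matrix_morphism r n \<mu> \<and> length cs = r \<and>
     (\<forall>a<r. list_all2 (list_all2 (\<lambda>c x. repr c = Some x)) (cs ! a) (mat_to_list (\<mu> [a]))) \<and>
     list_all2 (represents_test repr n) ts tests)"

definition passing_words ::
  "nat \<Rightarrow> (nat list \<Rightarrow> 's::{semiring_0,monoid_mult} mat) \<Rightarrow> ('s mat \<times> 's mat \<times> 's) list \<Rightarrow> nat list set" where
  "passing_words r \<mu> tests =
     {w \<in> lists {..<r}. \<forall>(\<alpha>, \<beta>, \<gamma>)\<in>set tests. (\<alpha> * \<mu> w * \<beta>) $$ (0, 0) = \<gamma>}"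

lemma list_all2_imp_lists:
  "list_all2 P xs ys \<Longrightarrow> (\<And>x y. P x y \<Longrightarrow> x \<in> A) \<Longrightarrow> xs \<in> lists A"
  by (induction rule: list_all2_induct) auto

lemma represents_test_dom:
  "represents_test repr n t T \<Longrightarrow> t \<in> lists (dom repr) \<times> lists (dom repr) \<times> dom repr"
  by (cases t; cases T) (auto simp: represents_test_def in_set_conv_nth)

lemma represents_problem_dom:
  assumes "represents_problem repr P r n \<mu> tests"
  shows "P \<in> UNIV \<times> (UNIV \<times> lists (lists (lists (dom repr)))) \<times>
    lists (lists (dom repr) \<times> lists (dom repr) \<times> dom repr)"
proof -
  obtain cs ts where P: "P = (r, (n, cs), ts)" and "length cs = r"
    and cs: "\<And>a. a < r \<Longrightarrow>
      list_all2 (list_all2 (\<lambda>c x. repr c = Some x)) (cs ! a) (mat_to_list (\<mu> [a]))"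
    and ts: "list_all2 (represents_test repr n) ts tests"
    using assms unfolding represents_problem_def by (cases P) auto
  have "cs ! a \<in> lists (lists (dom repr))" if "a < r" for a
    by (rule list_all2_imp_lists[OF cs[OF that]], erule list_all2_imp_lists) auto
  then have "cs \<in> lists (lists (lists (dom repr)))"
    using \<open>length cs = r\<close> by (metis in_listsI in_set_conv_nth)
  moreover have "ts \<in> lists (lists (dom repr) \<times> lists (dom repr) \<times> dom repr)"
    using list_all2_imp_lists[OF ts represents_test_dom] .
  ultimately show ?thesis
    unfolding P by (simp only: mem_Times_iff fst_conv snd_conv UNIV_I simp_thms)
qed

text \<open>
  Each test is turned into a machine over the finite semiring that separates its own right-hand
  side, and the machines run in parallel. The function \<open>G\<close> extracts the problem from an
  input given as a list of numbers. It is total, while the compilation itself is defined only for inputs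
  that represent a problem.
\<close>

lemma compile_tests:
  fixes repr :: "nat \<Rightarrow> 's::{semiring_0,monoid_mult} option" and G :: "nat list \<Rightarrow> problem"
  assumes onto: "\<forall>x. \<exists>c. repr c = Some x" and "effectively_separated Or repr"
    and G: "computable Or G"
  obtains f where "recursive_in Or f"
    and "\<And>xs r n \<mu> tests. represents_problem repr (G xs) r n \<mu> tests \<Longrightarrow>
      outputs_automaton_for (f (list_encode xs)) r (passing_words r \<mu> tests)"
proof -
  obtain R \<pi> t p where sep: "separated_via R \<pi>" and t: "recursive_in Or t"
    and t': "\<And>c \<gamma>. repr c = Some \<gamma> \<Longrightarrow> \<exists>k. t c = Some k \<and> codes_tables k (R \<gamma>)"
    and p: "recursive_in Or p"
    and p': "\<And>c d \<gamma> y. repr c = Some \<gamma> \<Longrightarrow> repr d = Some y \<Longrightarrow> p (prod_encode (c, d)) = Some (\<pi> \<gamma> y)"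
    using assms(2) unfolding effectively_separated_def by blast
  obtain c0 where c0: "repr c0 = Some 0"
    using onto by blast
  define tab where "tab c = the (t c)" for c
  define img where "img c d = the (p (prod_encode (c, d)))" for c d
  let ?V = "dom repr"
  let ?tests = "lists ?V \<times> lists ?V \<times> ?V"
  let ?D = "(UNIV \<times> (UNIV \<times> lists (lists (lists ?V))) \<times> lists ?tests) :: problem set"
  define f where "f z = automaton_code (parallel (fst z)
      (map (\<lambda>s. start_state tab img c0 (fst (fst (snd z))) (snd (fst (snd z))) s) (snd (snd z))))"
    for z :: problem
  have "computable_on Or ?D f"
  proof -
    have "computable_on Or ?V tab"
      unfolding computable_on_def tab_def
      by (intro exI[of _ t] conjI t) (use t' in fastforce)
    moreover have "computable_on Or (?V \<times> ?V) (\<lambda>z. img (fst z) (snd z))"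
      unfolding computable_on_def img_def
      by (intro exI[of _ p] conjI p) (use p' in fastforce)
    ultimately have *: "computable_on Or ((UNIV \<times> lists (lists (lists ?V))) \<times> ?tests)
        (\<lambda>z. start_state tab img c0 (fst (fst z)) (snd (fst z)) (snd z))"
      using c0 by (intro computable_start_state) auto
    have "computable_on Or (?D \<times> ?tests) (\<lambda>z. (fst (snd (fst z)), snd z))"
      by (intro computable_intros)
    then have "computable_on Or (?D \<times> ?tests)
        (\<lambda>z. (\<lambda>z. start_state tab img c0 (fst (fst z)) (snd (fst z)) (snd z)) (fst (snd (fst z)), snd z))"
      by (rule computable_on_comp[OF _ *]) auto
    then have **: "computable_on Or (?D \<times> ?tests)
        (\<lambda>z. start_state tab img c0 (fst (fst (snd (fst z)))) (snd (fst (snd (fst z)))) (snd z))"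
      by simp
    show "computable_on Or ?D f"
      unfolding f_def
    proof (rule computable_parallel)
      show "computable_on Or ?D (\<lambda>z. map
          (\<lambda>s. start_state tab img c0 (fst (fst (snd z))) (snd (fst (snd z))) s) (snd (snd z)))"
      proof (rule computable_map_on[OF _ **])
        fix z s assume z: "z \<in> ?D" and s: "s \<in> set (snd (snd z))"
        then have "snd (snd z) \<in> lists ?tests"
          by (simp only: mem_Times_iff)
        with s have "s \<in> ?tests"
          using in_listsD by blast
        with z show "(z, s) \<in> ?D \<times> ?tests"
          by (rule SigmaI)
      qed (intro computable_intros)
    qed (intro computable_intros)
  qed
  then have "computable_on Or (G -` ?D) (\<lambda>xs. f (G xs))"
    by (intro computable_on_comp[OF computable_on_subset[OF G]]) auto
  then obtain h where h: "recursive_in Or h"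
    and h': "\<And>xs. G xs \<in> ?D \<Longrightarrow> h (list_encode xs) = Some (f (G xs))"
    unfolding computable_on_def by (auto simp: encode_nat_list simp del: in_lists_conv_set)
  show thesis
  proof
    fix xs r n and \<mu> :: "nat list \<Rightarrow> 's mat" and tests
    assume rep: "represents_problem repr (G xs) r n \<mu> tests"
    then obtain cs ts where Gxs: "G xs = (r, (n, cs), ts)" and \<mu>: "matrix_morphism r n \<mu>"
      and "length cs = r" and cs: "\<And>a. a < r \<Longrightarrow>
        list_all2 (list_all2 (\<lambda>c x. repr c = Some x)) (cs ! a) (mat_to_list (\<mu> [a]))"
      and ts: "list_all2 (represents_test repr n) ts tests"
      unfolding represents_problem_def by (cases "G xs") auto
    have img: "img c d = \<pi> \<gamma> y" if "repr c = Some \<gamma>" "repr d = Some y" for c d \<gamma> y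
      using p'[OF that] by (simp add: img_def)
    (* What a machine has to satisfy to decide its test. This form mentions neither the finite
       semiring nor the morphism, which differ from test to test. *)
    define good where "good s test \<longleftrightarrow> (case test of (\<alpha>, \<beta>, \<gamma>) \<Rightarrow>
        (\<forall>a<r. \<forall>u\<in>set (machine_states (fst s)). machine_step a u \<in> set (machine_states (fst s))) \<and>
        s \<in> set (machine_states (fst s)) \<and>
        (\<forall>w\<in>lists {..<r}. machine_accepts (fold machine_step w s) \<longleftrightarrow> (\<alpha> * \<mu> w * \<beta>) $$ (0, 0) = \<gamma>))"
      for s :: "machine \<times> nat list" and test :: "'s mat \<times> 's mat \<times> 's"
    have good: "good (start_state tab img c0 n cs (a, b, g)) (\<alpha>, \<beta>, \<gamma>)"
      if test: "represents_test repr n (a, b, g) (\<alpha>, \<beta>, \<gamma>)" for a b g \<alpha> \<beta> \<gamma>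
    proof -
      have g: "repr g = Some \<gamma>"
        using test by (simp add: represents_test_def)
      have sep_\<gamma>: "semiring (R \<gamma>)" "semiring_morphism (\<pi> \<gamma>) (R \<gamma>)" "\<pi> \<gamma> -` {\<pi> \<gamma> \<gamma>} = {\<gamma>}"
        using sep unfolding separated_via_def by blast+
      have "codes_tables (tab g) (R \<gamma>)"
        using t'[OF g] by (auto simp: tab_def)
      then obtain es where "finite_image (R \<gamma>) (\<pi> \<gamma>) es (decode_tables (tab g))"
        using codes_tables_finite_image sep_\<gamma> by blast
      then interpret finite_image "R \<gamma>" "\<pi> \<gamma>" es "decode_tables (tab g)" .
      have mats: "map (map (map (img g))) cs =
          map (\<lambda>a. map (map (\<pi> \<gamma>)) (mat_to_list (\<mu> [a]))) [0..<r]"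
        using cs \<open>length cs = r\<close>
        by (auto intro!: nth_equalityI simp: list_all2_conv_all_nth img[OF g])
      have start: "start_state tab img c0 n cs (a, b, g) =
          (machine_for r n \<mu> \<beta> \<gamma>, entry_row (\<pi> \<gamma>) n \<alpha>)"
        using test unfolding start_state_def machine_for_def entry_row_def represents_test_def
        by (auto intro!: nth_equalityI simp: mats img[OF g] g c0)
      have \<alpha>: "\<alpha> \<in> carrier_mat 1 n" and \<beta>: "\<beta> \<in> carrier_mat n 1"
        using test by (auto simp: represents_test_def)
      have "\<alpha> * \<mu> w \<in> carrier_mat 1 n" if "w \<in> lists {..<r}" for w
        using \<alpha> \<mu> that unfolding matrix_morphism_def by (meson mult_carrier_mat)
      then show ?thesis
        unfolding start good_def
        using machine_step_closed[OF \<mu> \<beta> sep_\<gamma>(3)] machine_start[OF \<mu> \<beta> sep_\<gamma>(3)]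
          machine_run[OF \<mu> \<beta> sep_\<gamma>(3) _ \<alpha>] machine_accepts_iff[OF \<mu> \<beta> sep_\<gamma>(3)]
        by simp
    qed
    let ?ss = "map (start_state tab img c0 n cs) ts"
    have all_good: "list_all2 good ?ss tests"
      unfolding list_all2_map1 using ts
      by (rule list_all2_mono) (use good in auto)
    have *: "\<exists>test. good s test" if "s \<in> set ?ss" for s
      using all_good that by (metis in_set_conv_nth list_all2_nthD list_all2_lengthD)
    have closed: "machine_step a u \<in> set (machine_states (fst s))"
      if "a < r" "s \<in> set ?ss" "u \<in> set (machine_states (fst s))" for a s u
      using *[OF that(2)] that by (auto simp: good_def)
    have start: "s \<in> set (machine_states (fst s))" if "s \<in> set ?ss" for s
      using *[OF that] by (auto simp: good_def)
    have "(\<forall>s\<in>set ?ss. machine_accepts (fold machine_step w s)) \<longleftrightarrow>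
        (\<forall>(\<alpha>, \<beta>, \<gamma>)\<in>set tests. (\<alpha> * \<mu> w * \<beta>) $$ (0, 0) = \<gamma>)" if "w \<in> lists {..<r}" for w
      using all_good that
    proof (induction rule: list_all2_induct)
      case (Cons s ss test tests)
      then show ?case
        by (cases test) (simp add: good_def)
    qed simp
    moreover have "recognized (parallel r ?ss) =
        {w \<in> lists {..<r}. \<forall>s\<in>set ?ss. machine_accepts (fold machine_step w s)}"
      by (rule parallel_correct(2); fact closed start)
    ultimately have "recognized (parallel r ?ss) = passing_words r \<mu> tests"
      unfolding passing_words_def by (simp cong: conj_cong)
    moreover have "finite_automaton r (parallel r ?ss)"
      by (rule parallel_correct(1); fact closed start)
    ultimately show "outputs_automaton_for (h (list_encode xs)) r (passing_words r \<mu> tests)"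
      unfolding outputs_automaton_for_def h'[OF represents_problem_dom[OF rep]]
      by (intro exI[of _ "parallel r ?ss"]) (simp add: f_def Gxs)
  qed (rule h)
qed

section \<open>Reduction of rows and matrices to scalar tests\<close>

definition letters_of_code :: "nat \<Rightarrow> nat list list list" where
  "letters_of_code k = map decode_mat (list_decode k)"

definition row_of_code :: "nat \<Rightarrow> nat list" where
  "row_of_code k = nth_or [] (decode_mat k) 0"

definition column_of_code :: "nat \<Rightarrow> nat list" where
  "column_of_code k = map (\<lambda>row. nth_or 0 row 0) (decode_mat k)"

text \<open>
  Here \<open>c0\<close> and \<open>c1\<close> are codes of zero and one.
\<close>

definition unit_codes :: "nat \<Rightarrow> nat \<Rightarrow> nat \<Rightarrow> nat \<Rightarrow> nat list" where
  "unit_codes c0 c1 n j = map (\<lambda>k. if k = j then c1 else c0) [0..<n]"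

lemma computable_letters_of_code [computable_intros]:
  "computable_on Or D k \<Longrightarrow> computable_on Or D (\<lambda>e. letters_of_code (k e))"
  unfolding letters_of_code_def by (intro computable_intros)

lemma computable_row_of_code [computable_intros]:
  "computable_on Or D k \<Longrightarrow> computable_on Or D (\<lambda>e. row_of_code (k e))"
  unfolding row_of_code_def by (intro computable_intros)

lemma computable_column_of_code [computable_intros]:
  "computable_on Or D k \<Longrightarrow> computable_on Or D (\<lambda>e. column_of_code (k e))"
  unfolding column_of_code_def by (intro computable_intros)

lemma computable_unit_codes [computable_intros]:
  assumes "computable_on Or D n" and "computable_on Or D j"
  shows "computable_on Or D (\<lambda>e. unit_codes c0 c1 (n e) (j e))"
proof -
  have "computable Or (\<lambda>p. unit_codes c0 c1 (fst p) (snd p))"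
    unfolding unit_codes_def by (intro computable_intros)
  from computable_comp[OF this computable_Pair[OF assms]] show ?thesis
    by simp
qed

lemma letters_of_code:
  assumes "codes_morphism repr r k \<mu>"
  shows "length (letters_of_code k) = r"
    and "a < r \<Longrightarrow> list_all2 (list_all2 (\<lambda>c x. repr c = Some x)) (letters_of_code k ! a) (mat_to_list (\<mu> [a]))"
proof -
  have len: "length (list_decode k) = r"
    using assms by (auto simp: codes_morphism_def dest: list_all2_lengthD)
  then show "length (letters_of_code k) = r"
    by (simp add: letters_of_code_def)
  assume "a < r"
  then have "codes_matrix repr (list_decode k ! a) (\<mu> [a])"
    using assms len list_all2_nthD[of "codes_matrix repr" "list_decode k" "map (\<lambda>a. \<mu> [a]) [0..<r]" a]
    unfolding codes_morphism_def by auto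
  then show "list_all2 (list_all2 (\<lambda>c x. repr c = Some x)) (letters_of_code k ! a) (mat_to_list (\<mu> [a]))"
    using \<open>a < r\<close> len by (simp add: letters_of_code_def codes_matrix_def decode_mat_def)
qed

lemma row_of_code:
  assumes "codes_matrix repr k A" and "A \<in> carrier_mat 1 n"
  shows "length (row_of_code k) = n" and "i < n \<Longrightarrow> repr (row_of_code k ! i) = Some (A $$ (0, i))"
  using codes_matrix_entries[OF assms] by (simp_all add: row_of_code_def nth_or_def)

lemma column_of_code:
  assumes "codes_matrix repr k A" and "A \<in> carrier_mat n 1"
  shows "length (column_of_code k) = n" and "i < n \<Longrightarrow> repr (column_of_code k ! i) = Some (A $$ (i, 0))"
  using codes_matrix_entries[OF assms] by (simp_all add: column_of_code_def nth_or_def del: length_greater_0_conv)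

definition unit_row :: "nat \<Rightarrow> nat \<Rightarrow> 's::{zero,one} mat" where
  "unit_row n j = mat 1 n (\<lambda>(_, k). if k = j then 1 else 0)"

definition unit_column :: "nat \<Rightarrow> nat \<Rightarrow> 's::{zero,one} mat" where
  "unit_column n j = mat n 1 (\<lambda>(k, _). if k = j then 1 else 0)"

lemma unit_row_carrier [simp]: "unit_row n j \<in> carrier_mat (Suc 0) n"
  by (simp add: unit_row_def)

lemma unit_column_carrier [simp]: "unit_column n j \<in> carrier_mat n (Suc 0)"
  by (simp add: unit_column_def)

lemma unit_codes:
  assumes "repr c0 = Some 0" and "repr c1 = Some 1"
  shows "length (unit_codes c0 c1 n j) = n"
    and "i < n \<Longrightarrow> repr (unit_codes c0 c1 n j ! i) = Some (unit_row n j $$ (0, i))"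
    and "i < n \<Longrightarrow> repr (unit_codes c0 c1 n j ! i) = Some (unit_column n j $$ (i, 0))"
  using assms by (auto simp: unit_codes_def unit_row_def unit_column_def)

text \<open>
  Multiplication by unit vectors selects entries, which turns an equation between rows or matrices into scalar tests.
\<close>

lemma mult_unit_column:
  fixes A :: "'s::{semiring_0,monoid_mult} mat"
  assumes "A \<in> carrier_mat m n" and "i < m" and "j < n"
  shows "(A * unit_column n j) $$ (i, 0) = A $$ (i, j)"
  using assms
  by (subst mult_mat_entry[of A m n _ 1])
    (auto simp: unit_column_def if_distrib[of "\<lambda>x. _ * x"] sum.delta cong: if_cong)

lemma unit_row_mult:
  fixes A :: "'s::{semiring_0,monoid_mult} mat"
  assumes "A \<in> carrier_mat n m" and "i < n" and "j < m"
  shows "(unit_row n i * A) $$ (0, j) = A $$ (i, j)"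
  using assms
  by (subst mult_mat_entry[of _ 1 n _ m])
    (auto simp: unit_row_def if_distrib[of "\<lambda>x. x * _"] sum.delta cong: if_cong)

lemma outputs_automaton_imp_rational:
  "outputs_automaton_for res r L \<Longrightarrow> rational_language r L"
  by (auto simp: outputs_automaton_for_def rational_language_def)

section \<open>Constructibility\<close>

theorem theorem5:
  fixes repr :: "nat \<Rightarrow> 's::{semiring_0,monoid_mult} option"
    and sum_or prod_or eq_or :: "nat \<rightharpoonup> nat"
  assumes "effective_representation repr sum_or prod_or eq_or"
    and "effectively_separated {sum_or, prod_or, eq_or} repr"
  shows
    "(\<forall>r\<ge>1. \<forall>n\<ge>1. \<forall>\<alpha>\<in>carrier_mat 1 n. \<forall>\<eta>\<in>carrier_mat 1 n. \<forall>\<mu>. matrix_morphism r n \<mu> \<longrightarrow>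
       (\<forall>\<beta>\<in>carrier_mat n 1. \<forall>M\<in>carrier_mat n n. \<forall>\<gamma>::'s.
          rational_language r {w \<in> lists {..<r}. (\<alpha> * \<mu> w * \<beta>) $$ (0, 0) = \<gamma>} \<and>
          rational_language r {w \<in> lists {..<r}. \<alpha> * \<mu> w = \<eta>} \<and>
          rational_language r {w \<in> lists {..<r}. \<mu> w = M})) \<and>
     (\<exists>f. recursive_in {sum_or, prod_or, eq_or} f \<and>
        (\<forall>r\<ge>1. \<forall>n\<ge>1. \<forall>\<alpha>\<in>carrier_mat 1 n. \<forall>\<mu>. matrix_morphism r n \<mu> \<longrightarrow>
           (\<forall>\<beta>\<in>carrier_mat n 1. \<forall>\<gamma>. \<forall>ca cm cb cg.
              codes_matrix repr ca \<alpha> \<longrightarrow> codes_morphism repr r cm \<mu> \<longrightarrow>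
              codes_matrix repr cb \<beta> \<longrightarrow> repr cg = Some \<gamma> \<longrightarrow>
              outputs_automaton_for (f (list_encode [r, n, ca, cm, cb, cg])) r
                {w \<in> lists {..<r}. (\<alpha> * \<mu> w * \<beta>) $$ (0, 0) = \<gamma>}))) \<and>
     (\<exists>f. recursive_in {sum_or, prod_or, eq_or} f \<and>
        (\<forall>r\<ge>1. \<forall>n\<ge>1. \<forall>\<alpha>\<in>carrier_mat 1 n. \<forall>\<eta>\<in>carrier_mat 1 n. \<forall>\<mu>. matrix_morphism r n \<mu> \<longrightarrow>
           (\<forall>ca ce cm.
              codes_matrix repr ca \<alpha> \<longrightarrow> codes_matrix repr ce \<eta> \<longrightarrow>
              codes_morphism repr r cm \<mu> \<longrightarrow>
              outputs_automaton_for (f (list_encode [r, n, ca, ce, cm])) r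
                {w \<in> lists {..<r}. \<alpha> * \<mu> w = \<eta>}))) \<and>
     (\<exists>f. recursive_in {sum_or, prod_or, eq_or} f \<and>
        (\<forall>r\<ge>1. \<forall>n\<ge>1. \<forall>\<mu>. matrix_morphism r n \<mu> \<longrightarrow>
           (\<forall>M\<in>carrier_mat n n. \<forall>cm cM.
              codes_morphism repr r cm \<mu> \<longrightarrow> codes_matrix repr cM M \<longrightarrow>
              outputs_automaton_for (f (list_encode [r, n, cm, cM])) r
                {w \<in> lists {..<r}. \<mu> w = M})))"
proof -
  let ?Or = "{sum_or, prod_or, eq_or}"
  have onto: "\<forall>x. \<exists>c. repr c = Some x"
    using assms(1) by (simp add: effective_representation_def)
  (* The codes of zero and one are constants of the programs, so they need not be computed. *)
  then obtain c0 c1 where c0: "repr c0 = Some 0" and c1: "repr c1 = Some 1"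
    by metis
  note compile = compile_tests[OF onto assms(2)]
  note units = unit_codes[OF c0 c1]
  have bounded: "(\<forall>j\<in>{0..<n}. P j) \<longleftrightarrow> (\<forall>j<n. P j)" for P and n :: nat
    by auto

  have scalar: "\<exists>f. recursive_in ?Or f \<and>
      (\<forall>r\<ge>1. \<forall>n\<ge>1. \<forall>\<alpha>\<in>carrier_mat 1 n. \<forall>\<mu>. matrix_morphism r n \<mu> \<longrightarrow>
         (\<forall>\<beta>\<in>carrier_mat n 1. \<forall>\<gamma>. \<forall>ca cm cb cg.
            codes_matrix repr ca \<alpha> \<longrightarrow> codes_morphism repr r cm \<mu> \<longrightarrow>
            codes_matrix repr cb \<beta> \<longrightarrow> repr cg = Some \<gamma> \<longrightarrow>
            outputs_automaton_for (f (list_encode [r, n, ca, cm, cb, cg])) r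
              {w \<in> lists {..<r}. (\<alpha> * \<mu> w * \<beta>) $$ (0, 0) = \<gamma>}))"
  proof -
    define G where "G xs = (nth_or 0 xs 0, (nth_or 0 xs 1, letters_of_code (nth_or 0 xs 3)),
        [(row_of_code (nth_or 0 xs 2), column_of_code (nth_or 0 xs 4), nth_or 0 xs 5)])" for xs
    have "computable ?Or G"
      unfolding G_def by (intro computable_intros)
    then obtain f where "recursive_in ?Or f"
      and f: "\<And>xs r n \<mu> tests. represents_problem repr (G xs) r n \<mu> tests \<Longrightarrow>
        outputs_automaton_for (f (list_encode xs)) r (passing_words r \<mu> tests)"
      using compile by blast
    show ?thesis
    proof (intro exI conjI allI impI ballI)
      fix r n \<alpha> and \<mu> :: "nat list \<Rightarrow> 's mat" and \<beta> \<gamma> ca cm cb cg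
      assume \<alpha>: "\<alpha> \<in> carrier_mat 1 n" and \<mu>: "matrix_morphism r n \<mu>" and \<beta>: "\<beta> \<in> carrier_mat n 1"
        and codes: "codes_matrix repr ca \<alpha>" "codes_morphism repr r cm \<mu>" "codes_matrix repr cb \<beta>"
          "repr cg = Some \<gamma>"
      have "represents_problem repr (G [r, n, ca, cm, cb, cg]) r n \<mu> [(\<alpha>, \<beta>, \<gamma>)]"
        using \<alpha> \<beta> \<mu> codes letters_of_code[OF codes(2)] row_of_code[OF codes(1) \<alpha>]
          column_of_code[OF codes(3) \<beta>]
        by (simp add: represents_problem_def represents_test_def G_def nth_or_def)
      from f[OF this] show "outputs_automaton_for (f (list_encode [r, n, ca, cm, cb, cg])) r
          {w \<in> lists {..<r}. (\<alpha> * \<mu> w * \<beta>) $$ (0, 0) = \<gamma>}"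
        by (simp add: passing_words_def)
    qed fact
  qed

  have row: "\<exists>f. recursive_in ?Or f \<and>
      (\<forall>r\<ge>1. \<forall>n\<ge>1. \<forall>\<alpha>\<in>carrier_mat 1 n. \<forall>\<eta>\<in>carrier_mat 1 n. \<forall>\<mu>. matrix_morphism r n \<mu> \<longrightarrow>
         (\<forall>ca ce cm.
            codes_matrix repr ca \<alpha> \<longrightarrow> codes_matrix repr ce \<eta> \<longrightarrow>
            codes_morphism repr r cm \<mu> \<longrightarrow>
            outputs_automaton_for (f (list_encode [r, n, ca, ce, cm])) r
              {w \<in> lists {..<r}. \<alpha> * \<mu> w = \<eta>}))"
  proof -
    (* One test for each column of the row, all of them with the given row on the left. *)
    define G where "G xs = (nth_or 0 xs 0, (nth_or 0 xs 1, letters_of_code (nth_or 0 xs 4)),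
        map (\<lambda>j. (row_of_code (nth_or 0 xs 2), unit_codes c0 c1 (nth_or 0 xs 1) j,
          nth_or 0 (row_of_code (nth_or 0 xs 3)) j)) [0..<nth_or 0 xs 1])" for xs
    have "computable ?Or G"
      unfolding G_def by (intro computable_intros)
    then obtain f where "recursive_in ?Or f"
      and f: "\<And>xs r n \<mu> tests. represents_problem repr (G xs) r n \<mu> tests \<Longrightarrow>
        outputs_automaton_for (f (list_encode xs)) r (passing_words r \<mu> tests)"
      using compile by blast
    show ?thesis
    proof (intro exI conjI allI impI ballI)
      fix r n \<alpha> \<eta> and \<mu> :: "nat list \<Rightarrow> 's mat" and ca ce cm
      assume \<alpha>: "\<alpha> \<in> carrier_mat 1 n" and \<eta>: "\<eta> \<in> carrier_mat 1 n" and \<mu>: "matrix_morphism r n \<mu>"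
        and codes: "codes_matrix repr ca \<alpha>" "codes_matrix repr ce \<eta>" "codes_morphism repr r cm \<mu>"
      let ?tests = "map (\<lambda>j. (\<alpha>, unit_column n j, \<eta> $$ (0, j))) [0..<n]"
      have rep: "represents_problem repr (G [r, n, ca, ce, cm]) r n \<mu> ?tests"
        using \<alpha> \<mu> codes letters_of_code[OF codes(3)] row_of_code[OF codes(1) \<alpha>]
          row_of_code[OF codes(2) \<eta>] units
        by (simp add: represents_problem_def represents_test_def G_def nth_or_def list_all2_conv_all_nth)
      have lang: "passing_words r \<mu> ?tests = {w \<in> lists {..<r}. \<alpha> * \<mu> w = \<eta>}"
      proof -
        have "(\<forall>j<n. (\<alpha> * \<mu> w * unit_column n j) $$ (0, 0) = \<eta> $$ (0, j)) \<longleftrightarrow> \<alpha> * \<mu> w = \<eta>"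
          if "w \<in> lists {..<r}" for w
        proof -
          have "\<mu> w \<in> carrier_mat n n"
            using \<mu> that by (simp add: matrix_morphism_def)
          with \<alpha> have w: "\<alpha> * \<mu> w \<in> carrier_mat 1 n"
            by (rule mult_carrier_mat)
          then have "(\<alpha> * \<mu> w * unit_column n j) $$ (0, 0) = (\<alpha> * \<mu> w) $$ (0, j)" if "j < n" for j
            using mult_unit_column[OF w _ that, of 0] by simp
          moreover have "(\<forall>j<n. (\<alpha> * \<mu> w) $$ (0, j) = \<eta> $$ (0, j)) \<longleftrightarrow> \<alpha> * \<mu> w = \<eta>"
            using w \<eta> by (auto intro!: eq_matI simp del: index_mult_mat)
          ultimately show ?thesis
            by simp
        qed
        then show ?thesis
          by (simp add: passing_words_def bounded cong: conj_cong)
      qed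
      show "outputs_automaton_for (f (list_encode [r, n, ca, ce, cm])) r
          {w \<in> lists {..<r}. \<alpha> * \<mu> w = \<eta>}"
        using f[OF rep] unfolding lang .
    qed fact
  qed

  have matrix: "\<exists>f. recursive_in ?Or f \<and>
      (\<forall>r\<ge>1. \<forall>n\<ge>1. \<forall>\<mu>. matrix_morphism r n \<mu> \<longrightarrow>
         (\<forall>M\<in>carrier_mat n n. \<forall>cm cM.
            codes_morphism repr r cm \<mu> \<longrightarrow> codes_matrix repr cM M \<longrightarrow>
            outputs_automaton_for (f (list_encode [r, n, cm, cM])) r
              {w \<in> lists {..<r}. \<mu> w = M}))"
  proof -
    (* One test for each entry of the matrix. *)
    define G where "G xs = (nth_or 0 xs 0, (nth_or 0 xs 1, letters_of_code (nth_or 0 xs 2)),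
        concat (map (\<lambda>i. map (\<lambda>j. (unit_codes c0 c1 (nth_or 0 xs 1) i, unit_codes c0 c1 (nth_or 0 xs 1) j,
          nth_or 0 (nth_or [] (decode_mat (nth_or 0 xs 3)) i) j)) [0..<nth_or 0 xs 1]) [0..<nth_or 0 xs 1]))"
      for xs
    have "computable ?Or G"
      unfolding G_def by (intro computable_intros)
    then obtain f where "recursive_in ?Or f"
      and f: "\<And>xs r n \<mu> tests. represents_problem repr (G xs) r n \<mu> tests \<Longrightarrow>
        outputs_automaton_for (f (list_encode xs)) r (passing_words r \<mu> tests)"
      using compile by blast
    show ?thesis
    proof (intro exI conjI allI impI ballI)
      fix r n and \<mu> :: "nat list \<Rightarrow> 's mat" and M cm cM
      assume \<mu>: "matrix_morphism r n \<mu>" and M: "M \<in> carrier_mat n n"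
        and codes: "codes_morphism repr r cm \<mu>" "codes_matrix repr cM M"
      let ?tests = "concat (map (\<lambda>i. map (\<lambda>j. (unit_row n i, unit_column n j, M $$ (i, j))) [0..<n]) [0..<n])"
      have "list_all2 (represents_test repr n) (concat (map (\<lambda>i. map (\<lambda>j. (unit_codes c0 c1 n i,
          unit_codes c0 c1 n j, nth_or 0 (nth_or [] (decode_mat cM) i) j)) [0..<n]) [0..<n])) ?tests"
      proof (rule concat_transfer[THEN rel_funD])
        have "represents_test repr n
            (unit_codes c0 c1 n i, unit_codes c0 c1 n j, nth_or 0 (nth_or [] (decode_mat cM) i) j)
            (unit_row n i, unit_column n j, M $$ (i, j))" if "i < n" "j < n" for i j
          using that codes_matrix_entries[OF codes(2) M] units
          by (simp add: represents_test_def nth_or_def)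
        then show "list_all2 (list_all2 (represents_test repr n))
            (map (\<lambda>i. map (\<lambda>j. (unit_codes c0 c1 n i, unit_codes c0 c1 n j,
              nth_or 0 (nth_or [] (decode_mat cM) i) j)) [0..<n]) [0..<n])
            (map (\<lambda>i. map (\<lambda>j. (unit_row n i, unit_column n j, M $$ (i, j))) [0..<n]) [0..<n])"
          by (simp add: list_all2_map1 list_all2_map2 list_all2_same)
      qed
      then have rep: "represents_problem repr (G [r, n, cm, cM]) r n \<mu> ?tests"
        using \<mu> letters_of_code[OF codes(1)]
        by (simp add: represents_problem_def G_def nth_or_def[of _ "[r, n, cm, cM]"])
      have lang: "passing_words r \<mu> ?tests = {w \<in> lists {..<r}. \<mu> w = M}"
      proof -
        have "(\<forall>i<n. \<forall>j<n. (unit_row n i * \<mu> w * unit_column n j) $$ (0, 0) = M $$ (i, j)) \<longleftrightarrow> \<mu> w = M"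
          if "w \<in> lists {..<r}" for w
        proof -
          have w: "\<mu> w \<in> carrier_mat n n"
            using \<mu> that by (simp add: matrix_morphism_def)
          have "(unit_row n i * \<mu> w * unit_column n j) $$ (0, 0) = \<mu> w $$ (i, j)"
            if "i < n" "j < n" for i j
          proof -
            have "unit_row n i * \<mu> w \<in> carrier_mat 1 n"
              using w by (intro mult_carrier_mat) (simp_all add: unit_row_def)
            then show ?thesis
              using mult_unit_column[of "unit_row n i * \<mu> w" 1 n 0 j] unit_row_mult[OF w that] that
              by simp
          qed
          moreover have "(\<forall>i<n. \<forall>j<n. \<mu> w $$ (i, j) = M $$ (i, j)) \<longleftrightarrow> \<mu> w = M"
            using w M by (auto intro!: eq_matI)
          ultimately show ?thesis
            by simp
        qed
        then show ?thesis
          by (simp add: passing_words_def bounded cong: conj_cong)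
      qed
      show "outputs_automaton_for (f (list_encode [r, n, cm, cM])) r
          {w \<in> lists {..<r}. \<mu> w = M}"
        using f[OF rep] unfolding lang .
    qed fact
  qed

  show ?thesis
  proof (rule conjI[OF _ conjI[OF scalar conjI[OF row matrix]]], intro allI impI ballI)
    fix r n and \<alpha> \<eta> \<beta> M :: "'s mat" and \<mu> :: "nat list \<Rightarrow> 's mat" and \<gamma> :: 's
    assume r: "r \<ge> 1" and n: "n \<ge> 1" and \<alpha>: "\<alpha> \<in> carrier_mat 1 n" and \<eta>: "\<eta> \<in> carrier_mat 1 n"
      and \<mu>: "matrix_morphism r n \<mu>" and \<beta>: "\<beta> \<in> carrier_mat n 1" and M: "M \<in> carrier_mat n n"
    obtain ca ce cb cM cm cg where codes: "codes_matrix repr ca \<alpha>" "codes_matrix repr ce \<eta>"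
      "codes_matrix repr cb \<beta>" "codes_matrix repr cM M" "codes_morphism repr r cm \<mu>" "repr cg = Some \<gamma>"
      using codes_matrix_exists[OF onto] codes_morphism_exists[OF onto] onto by metis
    obtain f1 where "outputs_automaton_for (f1 (list_encode [r, n, ca, cm, cb, cg])) r
        {w \<in> lists {..<r}. (\<alpha> * \<mu> w * \<beta>) $$ (0, 0) = \<gamma>}"
      using scalar r n \<alpha> \<mu> \<beta> codes by blast
    moreover obtain f2 where "outputs_automaton_for (f2 (list_encode [r, n, ca, ce, cm])) r
        {w \<in> lists {..<r}. \<alpha> * \<mu> w = \<eta>}"
      using row r n \<alpha> \<eta> \<mu> codes by blast
    moreover obtain f3 where "outputs_automaton_for (f3 (list_encode [r, n, cm, cM])) r
        {w \<in> lists {..<r}. \<mu> w = M}"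
      using matrix r n \<mu> M codes by blast
    ultimately show "rational_language r {w \<in> lists {..<r}. (\<alpha> * \<mu> w * \<beta>) $$ (0, 0) = \<gamma>} \<and>
        rational_language r {w \<in> lists {..<r}. \<alpha> * \<mu> w = \<eta>} \<and>
        rational_language r {w \<in> lists {..<r}. \<mu> w = M}"
      using outputs_automaton_imp_rational by blast
  qed
qed

end
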